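(* For each nonzero $c\in\mathbb{C}$ there exists on $\mathbb{C}P^1$ a structure of a commutative regular algebraic three-valued coset group $\mathbb{G}_{3,c}(\mathbb{C}P^1)$ with neutral element $0$, inverse map $\mathrm{inv}(x)=-x$, and multiplication defined by the polynomial $p_{3,c}(z;-x,-y)$, where $$p_{3,c}(z;x,y)=\sigma_1^3-27\sigma_3+18c\,\sigma_1^2\sigma_3-54c\,\sigma_2\sigma_3-27c^2\sigma_2^2\sigma_3+81c^2\sigma_1\sigma_3^2$$ is a symmetric polynomial and $\sigma_k$ denotes the $k$-th elementary symmetric function of $x,y,z$. All such three-valued groups ($c\ne0$) are coset-isomorphic.
   Context: $\mathbb{C}P^1=\mathbb{C}\cup\{\infty\}$, $x=x_1/x_0$ for $(x_1:x_0)$, $\infty=(1:0)$. $\mathrm{Sym}^n(X)=X^n/\Sigma_n$; elements are multisets $[z_1,\dots,z_n]$. An algebraic $n$-valued group is an algebraic variety $X$ with a rational morphism $\ast:X\times X\to\mathrm{Sym}^n(X)$ which is associative (the $n^2$-multisets $[x\ast w\mid w\in y\ast z]$ and $[w\ast z\mid w\in x\ast y]$ coincide), a neutral element $e$ with $x\ast e=e\ast x=[x,\dots,x]$ for all $x$, and a rational morphism $\mathrm{inv}:X\to X$ such that, whenever $\mathrm{inv}(x)$ exists, $x\ast\mathrm{inv}(x)$ and $\mathrm{inv}(x)\ast x$ exist and contain $e$. It is regular if $\ast$ is defined on all of $X\times X$ and $\mathrm{inv}$ on all of $X$; commutative if $x\ast y=y\ast x$. The multiplication on $\mathbb{C}P^1$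 defined by a polynomial $P(z;x,y)$ of degree at most $n$ in each variable: $(x_1:x_0)\ast(y_1:y_0)$ is the multiset of $n$ zeros (with multiplicity) in $(z_1:z_0)$ of the form $(x_0y_0z_0)^nP(z_1/z_0;x_1/x_0,y_1/y_0)$. Coset construction: for a (1-valued) group $G$ and a subgroup $H\subset\mathrm{Aut}(G)$ of order $n$, with projection $\pi:G\to G/H$, the coset $n$-valued group $G_H$ is $G/H$ with $\pi(u)\ast\pi(v)=[\pi(u\cdot h(v))\mid h\in H]$, neutral element $\pi(e)$, $\mathrm{inv}(\pi(u))=\pi(u^{-1})$. Here the coset structure on $\mathbb{G}_{3,c}(\mathbb{C}P^1)$ is that of the group of points of the elliptic curve $\mathcal{E}=\{\eta^2=\zeta^3+c\}$ (neutral element the point $\infty$) and the order-$3$ group generated by $\phi_3:(\zeta,\eta)\mapsto(e^{2\pi i/3}\zeta,\eta)$, $\infty\mapsto\infty$, the orbit space being identified with $\mathbb{C}P^1$ by $(\zeta,\eta)\mapsto1/\eta$, $\infty\mapsto0$. Coset groups $M_A$ and $N_B$ ($A\subset\mathrm{Aut}(M)$, $B\subset\mathrm{Aut}(N)$ of order $n$) are coset-isomorphic if there exist isomorphisms $\widetilde\varphi:M\to N$ (of algebraic groups) and $\varphi:M/A\to N/B$ compatible with the projections $M\to M/A$, $N\to N/B$, with the maps $M\times M\to\mathrm{Sym}^n(M)$, $(m_1,m_2)\mapsto[m_1\cdot a(m_2)\mid a\in A]$ (and likewise for $N$), and with the $n$-valued multiplications on $M/A$, $N/B$. *)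

theory Defs
  imports
    "HOL-Analysis.Analysis"
    "HOL-Computational_Algebra.Polynomial"
    "HOL-Library.Multiset"
    "HOL-Algebra.Bij"
    "HOL-Algebra.Generated_Groups"
begin

text \<open>The type \<open>'n proj\<close> is the projective space of lines in \<open>complex ^ 'n\<close>,
  of dimension \<open>CARD('n) - 1\<close>.  It is a partial quotient, so \<open>abs_proj v\<close> is meaningful
  for \<open>v \<noteq> 0\<close> only.\<close>

quotient_type (overloaded) 'n proj = "complex ^ ('n::finite)" / partial:
  "\<lambda>v w. v \<noteq> 0 \<and> w \<noteq> 0 \<and> (\<exists>k. k \<noteq> 0 \<and> w = k *s v)"
proof (rule part_equivpI)
  show "\<exists>v::complex^'n. v \<noteq> 0 \<and> v \<noteq> 0 \<and> (\<exists>k. k \<noteq> 0 \<and> v = k *s v)"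
    by (rule exI[of _ "vec 1"]) (auto simp: vec_eq_iff intro!: exI[of _ 1])
  show "symp (\<lambda>v w::complex^'n. v \<noteq> 0 \<and> w \<noteq> 0 \<and> (\<exists>k. k \<noteq> 0 \<and> w = k *s v))"
  proof (rule sympI, elim conjE exE, intro conjI)
    fix v w :: "complex^'n" and k assume "k \<noteq> 0" "w = k *s v"
    then have "inverse k \<noteq> 0 \<and> v = inverse k *s w" by (simp add: vector_smult_assoc)
    then show "\<exists>k. k \<noteq> 0 \<and> v = k *s w" by blast
  qed
  show "transp (\<lambda>v w::complex^'n. v \<noteq> 0 \<and> w \<noteq> 0 \<and> (\<exists>k. k \<noteq> 0 \<and> w = k *s v))"
  proof (rule transpI, elim conjE exE, intro conjI)
    fix u v w :: "complex^'n" and k l assume "k \<noteq> 0" "v = k *s u" "l \<noteq> 0" "w = l *s v"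
    then have "l * k \<noteq> 0 \<and> w = (l * k) *s u" by (simp add: vector_smult_assoc)
    then show "\<exists>k. k \<noteq> 0 \<and> w = k *s u" by blast
  qed
qed

lift_definition coord_ratio :: "'n::finite \<Rightarrow> 'n \<Rightarrow> 'n proj \<Rightarrow> complex"
  is "\<lambda>i j v. v $ i / v $ j"
  by auto

type_synonym CP1 = "2 proj"

text \<open>The point \<open>(x1 : x0)\<close> of the projective line is the class of the vector with
  components \<open>$ 1 = x1\<close> and \<open>$ 2 = x0\<close>.\<close>

definition CP1_pt :: "complex \<Rightarrow> complex \<Rightarrow> CP1"
  where "CP1_pt x1 x0 = abs_proj (vector [x1, x0])"

definition of_complex :: "complex \<Rightarrow> CP1"
  where "of_complex x = CP1_pt x 1"

definition CP1_inf :: CP1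
  where "CP1_inf = CP1_pt 1 0"

lift_definition CP1_uminus :: "CP1 \<Rightarrow> CP1"
  is "\<lambda>v. vector [- (v $ 1), v $ 2]"
  by (auto simp: vec_eq_iff forall_2)

inductive hom_poly :: "nat \<Rightarrow> (complex ^ 'm \<Rightarrow> complex) \<Rightarrow> bool" where
  const: "hom_poly 0 (\<lambda>v. a)"
| coord: "hom_poly 1 (\<lambda>v. v $ i)"
| add: "hom_poly d F \<Longrightarrow> hom_poly d G \<Longrightarrow> hom_poly d (\<lambda>v. F v + G v)"
| mult: "hom_poly d F \<Longrightarrow> hom_poly e G \<Longrightarrow> hom_poly (d + e) (\<lambda>v. F v * G v)"

inductive bihom_poly :: "nat \<Rightarrow> nat \<Rightarrow> (complex ^ 'm \<Rightarrow> complex ^ 'n \<Rightarrow> complex) \<Rightarrow> bool" where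
  const: "bihom_poly 0 0 (\<lambda>v w. a)"
| coord1: "bihom_poly 1 0 (\<lambda>v w. v $ i)"
| coord2: "bihom_poly 0 1 (\<lambda>v w. w $ j)"
| add: "bihom_poly d e F \<Longrightarrow> bihom_poly d e G \<Longrightarrow> bihom_poly d e (\<lambda>v w. F v w + G v w)"
| mult: "bihom_poly d e F \<Longrightarrow> bihom_poly d' e' G \<Longrightarrow>
    bihom_poly (d + d') (e + e') (\<lambda>v w. F v w * G v w)"

definition proj_closed :: "'m::finite proj set \<Rightarrow> bool"
  where "proj_closed S \<longleftrightarrow> (\<exists>\<F>. (\<forall>F\<in>\<F>. \<exists>d. hom_poly d F) \<and>
    S = {abs_proj v | v. v \<noteq> 0 \<and> (\<forall>F\<in>\<F>. F v = 0)})"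

definition quasi_projective :: "'m::finite proj set \<Rightarrow> bool"
  where "quasi_projective S \<longleftrightarrow> (\<exists>A B. proj_closed A \<and> proj_closed B \<and> S = A - B)"

text \<open>A map is regular if near every point it is given by homogeneous polynomials of the same
  degree.  Requiring the formula wherever these polynomials do not all vanish, and not only on
  some smaller neighbourhood of the point, is no restriction: multiply the polynomials by a form
  that vanishes outside the neighbourhood but not at the point.\<close>

definition regular_map :: "'m::finite proj set \<Rightarrow> ('m proj \<Rightarrow> 'n::finite proj) \<Rightarrow> bool"
  where "regular_map S f \<longleftrightarrow>
    (\<forall>v0. v0 \<noteq> 0 \<and> abs_proj v0 \<in> S \<longrightarrow>
      (\<exists>d F. (\<forall>i. hom_poly d (F i)) \<and> (\<chi> i. F i v0) \<noteq> 0 \<and>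
        (\<forall>v. v \<noteq> 0 \<and> abs_proj v \<in> S \<and> (\<chi> i. F i v) \<noteq> 0 \<longrightarrow>
          f (abs_proj v) = abs_proj (\<chi> i. F i v))))"

definition regular_map2 ::
    "'m::finite proj set \<Rightarrow> 'n::finite proj set \<Rightarrow> ('m proj \<Rightarrow> 'n proj \<Rightarrow> 'k::finite proj) \<Rightarrow> bool"
  where "regular_map2 S T f \<longleftrightarrow>
    (\<forall>v0 w0. v0 \<noteq> 0 \<and> w0 \<noteq> 0 \<and> abs_proj v0 \<in> S \<and> abs_proj w0 \<in> T \<longrightarrow>
      (\<exists>d e F. (\<forall>i. bihom_poly d e (F i)) \<and> (\<chi> i. F i v0 w0) \<noteq> 0 \<and>
        (\<forall>v w. v \<noteq> 0 \<and> w \<noteq> 0 \<and> abs_proj v \<in> S \<and> abs_proj w \<in> T \<and> (\<chi> i. F i v w) \<noteq> 0 \<longrightarrow>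
          f (abs_proj v) (abs_proj w) = abs_proj (\<chi> i. F i v w))))"

definition biregular :: "'m::finite proj set \<Rightarrow> 'n::finite proj set \<Rightarrow> ('m proj \<Rightarrow> 'n proj) \<Rightarrow> bool"
  where "biregular S T f \<longleftrightarrow>
    bij_betw f S T \<and> regular_map S f \<and> regular_map T (inv_into S f)"

text \<open>The zeros in \<open>(z1 : z0)\<close>, with multiplicity, of the binary form
  \<open>\<Sum>i\<le>n. b i * z1 ^ i * z0 ^ (n - i)\<close>, which has to be nonzero.  The point at infinity is a zero
  of multiplicity \<open>n\<close> minus the degree of the dehomogenized form.\<close>

definition form_zeros :: "nat \<Rightarrow> (nat \<Rightarrow> complex) \<Rightarrow> CP1 multiset"
  where "form_zeros n b = (let q = (\<Sum>i\<le>n. monom (b i) i) in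
    image_mset of_complex (proots q) + replicate_mset (n - degree q) CP1_inf)"

text \<open>The variety structure on the \<open>n\<close>-th symmetric power of the projective line is that of the
  projective space of binary forms of degree \<open>n\<close>, a form corresponding to the multiset of its
  zeros.  Its homogeneous coordinates are the coefficients of the form.\<close>

definition regular_map2_Sym :: "nat \<Rightarrow> (CP1 \<Rightarrow> CP1 \<Rightarrow> CP1 multiset) \<Rightarrow> bool"
  where "regular_map2_Sym n f \<longleftrightarrow>
    (\<forall>v0 w0. v0 \<noteq> 0 \<and> w0 \<noteq> 0 \<longrightarrow>
      (\<exists>d e F. (\<forall>i\<le>n. bihom_poly d e (F i)) \<and> (\<exists>i\<le>n. F i v0 w0 \<noteq> 0) \<and>
        (\<forall>v w. v \<noteq> 0 \<and> w \<noteq> 0 \<and> (\<exists>i\<le>n. F i v w \<noteq> 0) \<longrightarrow>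
          f (abs_proj v) (abs_proj w) = form_zeros n (\<lambda>i. F i v w))))"

definition multivalued_group ::
    "nat \<Rightarrow> ('a \<Rightarrow> 'a \<Rightarrow> 'a multiset) \<Rightarrow> 'a \<Rightarrow> ('a \<Rightarrow> 'a) \<Rightarrow> bool"
  where "multivalued_group n mul e iv \<longleftrightarrow>
    (\<forall>x y. size (mul x y) = n) \<and>
    (\<forall>x y z. (\<Sum>w\<in>#mul y z. mul x w) = (\<Sum>w\<in>#mul x y. mul w z)) \<and>
    (\<forall>x. mul x e = replicate_mset n x \<and> mul e x = replicate_mset n x) \<and>
    (\<forall>x. e \<in># mul x (iv x) \<and> e \<in># mul (iv x) x)"

definition regular_algebraic_multivalued_group ::
    "nat \<Rightarrow> (CP1 \<Rightarrow> CP1 \<Rightarrow> CP1 multiset) \<Rightarrow> CP1 \<Rightarrow> (CP1 \<Rightarrow> CP1) \<Rightarrow> bool"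
  where "regular_algebraic_multivalued_group n mul e iv \<longleftrightarrow>
    multivalued_group n mul e iv \<and> regular_map2_Sym n mul \<and> regular_map UNIV iv"

definition commutative_mult :: "('a \<Rightarrow> 'a \<Rightarrow> 'a multiset) \<Rightarrow> bool"
  where "commutative_mult mul \<longleftrightarrow> (\<forall>x y. mul x y = mul y x)"

text \<open>The coefficients \<open>a i j k\<close> are determined by \<open>P\<close>; their existence says that \<open>P\<close> is a
  polynomial of degree at most \<open>n\<close> in each variable.\<close>

definition mult_defined_by ::
    "nat \<Rightarrow> (complex \<Rightarrow> complex \<Rightarrow> complex \<Rightarrow> complex) \<Rightarrow> (CP1 \<Rightarrow> CP1 \<Rightarrow> CP1 multiset) \<Rightarrow> bool"
  where "mult_defined_by n P mul \<longleftrightarrow>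
    (\<exists>a. (\<forall>z x y. P z x y = (\<Sum>i\<le>n. \<Sum>j\<le>n. \<Sum>k\<le>n. a i j k * z ^ i * x ^ j * y ^ k)) \<and>
      (\<forall>x1 x0 y1 y0. (x1, x0) \<noteq> (0, 0) \<and> (y1, y0) \<noteq> (0, 0) \<longrightarrow>
        (let b = (\<lambda>i. \<Sum>j\<le>n. \<Sum>k\<le>n.
                    a i j k * x1 ^ j * x0 ^ (n - j) * y1 ^ k * y0 ^ (n - k))
         in (\<exists>i\<le>n. b i \<noteq> 0) \<and> mul (CP1_pt x1 x0) (CP1_pt y1 y0) = form_zeros n b)))"

text \<open>Every complex algebraic group is quasi-projective, so considering locally closed subsets of
  projective spaces is no restriction.\<close>

definition algebraic_group :: "('m::finite proj, 'r) monoid_scheme \<Rightarrow> bool"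
  where "algebraic_group G \<longleftrightarrow>
    group G \<and> quasi_projective (carrier G) \<and>
    regular_map2 (carrier G) (carrier G) (\<lambda>x y. x \<otimes>\<^bsub>G\<^esub> y) \<and>
    regular_map (carrier G) (\<lambda>x. inv\<^bsub>G\<^esub> x)"

definition algebraic_group_iso ::
    "('m::finite proj, 'r) monoid_scheme \<Rightarrow> ('n::finite proj, 's) monoid_scheme \<Rightarrow>
     ('m proj \<Rightarrow> 'n proj) \<Rightarrow> bool"
  where "algebraic_group_iso G G' f \<longleftrightarrow> f \<in> iso G G' \<and> biregular (carrier G) (carrier G') f"

text \<open>The coset group of \<open>G\<close> by the group \<open>H\<close> of automorphisms, the orbit space being identified
  with the projective line by means of the morphism \<open>p\<close>, whose fibres are the orbits.  As the
  projective line is normal and the characteristic is zero, such a \<open>p\<close> identifies it with \<open>G / H\<close>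
  also as a variety.\<close>

definition coset_group ::
    "nat \<Rightarrow> ('m::finite proj, 'r) monoid_scheme \<Rightarrow> ('m proj \<Rightarrow> 'm proj) set \<Rightarrow> ('m proj \<Rightarrow> CP1) \<Rightarrow>
     (CP1 \<Rightarrow> CP1 \<Rightarrow> CP1 multiset) \<Rightarrow> CP1 \<Rightarrow> (CP1 \<Rightarrow> CP1) \<Rightarrow> bool"
  where "coset_group n G H p mul e iv \<longleftrightarrow>
    algebraic_group G \<and>
    subgroup H (AutoGroup G) \<and> (\<forall>h\<in>H. algebraic_group_iso G G h) \<and> finite H \<and> card H = n \<and>
    regular_map (carrier G) p \<and> p ` carrier G = UNIV \<and>
    (\<forall>u\<in>carrier G. \<forall>v\<in>carrier G. p u = p v \<longleftrightarrow> (\<exists>h\<in>H. v = h u)) \<and>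
    (\<forall>u\<in>carrier G. \<forall>v\<in>carrier G. mul (p u) (p v) = {# p (u \<otimes>\<^bsub>G\<^esub> h v). h \<in># mset_set H #}) \<and>
    e = p \<one>\<^bsub>G\<^esub> \<and>
    (\<forall>u\<in>carrier G. iv (p u) = p (inv\<^bsub>G\<^esub> u))"

definition coset_isomorphic ::
    "('m::finite proj, 'r) monoid_scheme \<Rightarrow> ('m proj \<Rightarrow> 'm proj) set \<Rightarrow> ('m proj \<Rightarrow> CP1) \<Rightarrow>
     (CP1 \<Rightarrow> CP1 \<Rightarrow> CP1 multiset) \<Rightarrow>
     ('n::finite proj, 's) monoid_scheme \<Rightarrow> ('n proj \<Rightarrow> 'n proj) set \<Rightarrow> ('n proj \<Rightarrow> CP1) \<Rightarrow>
     (CP1 \<Rightarrow> CP1 \<Rightarrow> CP1 multiset) \<Rightarrow> bool"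
  where "coset_isomorphic M A p mul N B q mul' \<longleftrightarrow>
    (\<exists>\<phi>' \<phi>. algebraic_group_iso M N \<phi>' \<and> biregular UNIV UNIV \<phi> \<and>
      (\<forall>m\<in>carrier M. q (\<phi>' m) = \<phi> (p m)) \<and>
      (\<forall>m1\<in>carrier M. \<forall>m2\<in>carrier M.
        image_mset \<phi>' {# m1 \<otimes>\<^bsub>M\<^esub> a m2. a \<in># mset_set A #} =
        {# \<phi>' m1 \<otimes>\<^bsub>N\<^esub> b (\<phi>' m2). b \<in># mset_set B #}) \<and>
      (\<forall>x y. image_mset \<phi> (mul x y) = mul' (\<phi> x) (\<phi> y)))"

text \<open>The affine point \<open>(\<zeta>, \<eta>)\<close> has homogeneous coordinates \<open>$ 1 = \<zeta>\<close>, \<open>$ 2 = \<eta>\<close>, \<open>$ 3 = 1\<close>.\<close>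

type_synonym CP2 = "3 proj"

definition aff_pt :: "complex \<Rightarrow> complex \<Rightarrow> CP2"
  where "aff_pt \<zeta> \<eta> = abs_proj (vector [\<zeta>, \<eta>, 1])"

definition inf_pt :: CP2
  where "inf_pt = abs_proj (vector [0, 1, 0])"

abbreviation zeta_coord :: "CP2 \<Rightarrow> complex"
  where "zeta_coord \<equiv> coord_ratio 1 3"

abbreviation eta_coord :: "CP2 \<Rightarrow> complex"
  where "eta_coord \<equiv> coord_ratio 2 3"

definition curve :: "complex \<Rightarrow> CP2 set"
  where "curve c = {inf_pt} \<union> {aff_pt \<zeta> \<eta> | \<zeta> \<eta>. \<eta> ^ 2 = \<zeta> ^ 3 + c}"

text \<open>Chord-tangent addition; \<open>l\<close> is the slope of the chord, or of the tangent if \<open>u = v\<close>.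
  It is meant for two points of one and the same \<open>curve c\<close> and does not mention \<open>c\<close>.\<close>

definition curve_add :: "CP2 \<Rightarrow> CP2 \<Rightarrow> CP2"
  where "curve_add u v =
    (if u = inf_pt then v
     else if v = inf_pt then u
     else let x1 = zeta_coord u; y1 = eta_coord u; x2 = zeta_coord v; y2 = eta_coord v in
       if x1 = x2 \<and> y1 = - y2 then inf_pt
       else let l = (if x1 = x2 then 3 * x1 ^ 2 / (2 * y1) else (y2 - y1) / (x2 - x1));
                x3 = l ^ 2 - x1 - x2
            in aff_pt x3 (l * (x1 - x3) - y1))"

definition curve_group :: "complex \<Rightarrow> CP2 monoid"
  where "curve_group c = \<lparr>carrier = curve c, mult = curve_add, one = inf_pt\<rparr>"

text \<open>Automorphisms are restricted to the carrier because the elements of \<open>AutoGroup\<close> are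
  extensional functions.\<close>

definition phi3 :: "complex \<Rightarrow> CP2 \<Rightarrow> CP2"
  where "phi3 c = restrict
    (\<lambda>u. if u = inf_pt then inf_pt
         else aff_pt (exp (2 * of_real pi * \<i> / 3) * zeta_coord u) (eta_coord u)) (curve c)"

definition phi3_group :: "complex \<Rightarrow> (CP2 \<Rightarrow> CP2) set"
  where "phi3_group c = generate (AutoGroup (curve_group c)) {phi3 c}"

text \<open>The map \<open>(\<zeta>, \<eta>) \<mapsto> 1 / \<eta>\<close>, with value \<open>\<infinity>\<close> where \<open>\<eta> = 0\<close>.\<close>

definition curve_proj :: "CP2 \<Rightarrow> CP1"
  where "curve_proj u = (if u = inf_pt then of_complex 0 else CP1_pt 1 (eta_coord u))"

definition p3 :: "complex \<Rightarrow> complex \<Rightarrow> complex \<Rightarrow> complex \<Rightarrow> complex"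
  where "p3 c z x y =
    (let \<sigma>1 = x + y + z; \<sigma>2 = x * y + y * z + z * x; \<sigma>3 = x * y * z in
      \<sigma>1 ^ 3 - 27 * \<sigma>3 + 18 * c * \<sigma>1 ^ 2 * \<sigma>3 - 54 * c * \<sigma>2 * \<sigma>3
        - 27 * c ^ 2 * \<sigma>2 ^ 2 * \<sigma>3 + 81 * c ^ 2 * \<sigma>1 * \<sigma>3 ^ 2)"

text \<open>The two transpositions generate all permutations of the variables.\<close>

definition symmetric3 :: "('a \<Rightarrow> 'a \<Rightarrow> 'a \<Rightarrow> 'b) \<Rightarrow> bool"
  where "symmetric3 P \<longleftrightarrow> (\<forall>x y z. P x y z = P y x z \<and> P x y z = P x z y)"

definition is_G3 :: "complex \<Rightarrow> (CP1 \<Rightarrow> CP1 \<Rightarrow> CP1 multiset) \<Rightarrow> bool"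
  where "is_G3 c mul \<longleftrightarrow>
    regular_algebraic_multivalued_group 3 mul (of_complex 0) CP1_uminus \<and>
    commutative_mult mul \<and>
    coset_group 3 (curve_group c) (phi3_group c) curve_proj mul (of_complex 0) CP1_uminus \<and>
    mult_defined_by 3 (\<lambda>z x y. p3 c z (- x) (- y)) mul"

end

theory Submission
  imports Defs
begin

text \<open>
  The difficult points are the group structure of the curve \<open>\<eta> ^ 2 = \<zeta> ^ 3 + c\<close> and the fact that the
  roots of \<open>p3\<close>, with multiplicities, are the projections of \<open>u + \<phi> ^ k v\<close> for \<open>k = 0, 1, 2\<close>, where \<open>\<phi>\<close>
  is the automorphism of order three.  Both become short in other coordinates.  For
  \<open>r ^ 2 = - 3 c\<close> the linear forms \<open>U = r Z + Y\<close> and \<open>V = r Z - Y\<close> turn the curve into the Fermat cubic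
  \<open>W ^ 3 + U ^ 3 + V ^ 3 = 0\<close>, where \<open>W\<close> is a multiple of \<open>X\<close>.  There \<open>\<phi>\<close> multiplies \<open>W\<close> by a cube root
  of unity and fixes \<open>U\<close> and \<open>V\<close>, the orbit space becomes the line with coordinate \<open>(U : V)\<close>, and
  addition is given by three binomials of bidegree \<open>(2, 2)\<close>.

  These binomials vanish simultaneously at some pairs of points.  The cyclic permutation of the
  coordinates is a translation by a point of order three, and conjugating the binomials with it
  yields two more laws for the same addition.  At most one of the three laws vanishes at a given
  pair (\<open>fermat_law_exceptional\<close>).  So the law gives a sum for all pairs, and associativity for all
  triples follows from a single polynomial identity after suitable translations
  (\<open>fermat_sum_assoc\<close>).  Comparing with chords and tangents (\<open>curve_add_eq_iff\<close>) transfers the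
  group axioms to the curve, and the laws are the formulas that make its addition regular.

  In the coordinates \<open>U\<close> and \<open>V\<close> the polynomial \<open>p3 c z (- x) (- y)\<close> is a constant multiple of
  \<open>(U3 V1 V2 + V3 U1 U2) ^ 3 - (U1 ^ 3 + V1 ^ 3) (U2 ^ 3 + V2 ^ 3) (U3 ^ 3 + V3 ^ 3)\<close>.  The linear form in
  \<open>U3\<close> and \<open>V3\<close> that vanishes at \<open>u + \<phi> ^ k v\<close> is read off from an addition law; the product over
  \<open>k\<close> is a norm from which \<open>W1\<close> and \<open>W2\<close> can be eliminated up to a factor free of \<open>U3\<close> and \<open>V3\<close>, and
  it equals this expression times that factor (\<open>norm_form_factorization\<close>).  For
  special \<open>u\<close> and \<open>v\<close> each of the three laws vanishes at one of the pairs \<open>u\<close>, \<open>\<phi> ^ k v\<close>; to have a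
  nonzero product there as well, the identity is proved for a one-parameter family of laws (\<open>form_zeros_p3_form\<close>).

  The axioms of a multivalued group hold for every coset construction
  (\<open>multivalued_group_if_coset_group\<close>).  Finally, the curves for different \<open>c\<close> are identified by
  \<open>(\<zeta>, \<eta>) \<mapsto> (t ^ 2 \<zeta>, t ^ 3 \<eta>)\<close>, which commutes with \<open>\<phi>\<close>.
\<close>

section \<open>Proportional vectors\<close>

definition par :: "complex ^ 3 \<Rightarrow> complex ^ 3 \<Rightarrow> bool" where
  "par v w \<longleftrightarrow> v$1 * w$2 = v$2 * w$1 \<and> v$2 * w$3 = v$3 * w$2 \<and> v$3 * w$1 = v$1 * w$3"

lemma vec3_eq_iff: "(v :: complex ^ 3) = w \<longleftrightarrow> v$1 = w$1 \<and> v$2 = w$2 \<and> v$3 = w$3"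
  by (simp add: vec_eq_iff forall_3)

lemma par_refl: "par v v"
  by (simp add: par_def)

lemma par_sym: "par v w \<Longrightarrow> par w v"
  unfolding par_def by (metis mult.commute)

lemma par_imp_multiple:
  assumes "v \<noteq> 0" "par v w"
  shows "\<exists>k. w = k *s v"
proof -
  consider "v$1 \<noteq> 0" | "v$2 \<noteq> 0" | "v$3 \<noteq> 0"
    using assms(1) by (auto simp: vec3_eq_iff)
  then show ?thesis
  proof cases
    case 1 then show ?thesis using assms(2)
      by (intro exI[of _ "w$1 / v$1"]) (auto simp: vec3_eq_iff par_def field_simps)
  next
    case 2 then show ?thesis using assms(2)
      by (intro exI[of _ "w$2 / v$2"]) (auto simp: vec3_eq_iff par_def field_simps)
  next
    case 3 then show ?thesis using assms(2)
      by (intro exI[of _ "w$3 / v$3"]) (auto simp: vec3_eq_iff par_def field_simps)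
  qed
qed

lemma par_iff_multiple:
  assumes "v \<noteq> 0" "w \<noteq> 0"
  shows "par v w \<longleftrightarrow> (\<exists>k. k \<noteq> 0 \<and> w = k *s v)"
proof
  assume "par v w"
  then show "\<exists>k. k \<noteq> 0 \<and> w = k *s v"
    using par_imp_multiple[OF assms(1)] assms(2) by (metis vector_smult_lzero)
qed (auto simp: par_def)

lemma par_trans: "par u v \<Longrightarrow> par v w \<Longrightarrow> v \<noteq> 0 \<Longrightarrow> par u w"
  using par_imp_multiple[of v w] par_imp_multiple[of v u] par_sym[of u v] by (auto simp: par_def)

section \<open>Addition on the Fermat cubic\<close>

definition fermat_point :: "complex ^ 3 \<Rightarrow> bool" where
  "fermat_point v \<longleftrightarrow> v \<noteq> 0 \<and> v$1 ^ 3 + v$2 ^ 3 + v$3 ^ 3 = 0"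

text \<open>The cyclic permutation of the coordinates maps the cubic to itself.  It is the translation by the
point \<open>(1 : -1 : 0)\<close> of order three.\<close>

definition rot :: "complex ^ 3 \<Rightarrow> complex ^ 3" where
  "rot v = vector [v$2, v$3, v$1]"

text \<open>The classical addition law on Hessian cubics \<open>x ^ 3 + y ^ 3 + z ^ 3 = d x y z\<close>, with neutral
point \<open>(0 : 1 : -1)\<close>; it is the same for all \<open>d\<close>, here \<open>d = 0\<close>.  Negation exchanges the last two
coordinates.  There are pairs at which all three components vanish, for instance
\<open>u = v\<close>, so that doubling needs another formula.\<close>

definition fermat_law :: "complex ^ 3 \<Rightarrow> complex ^ 3 \<Rightarrow> complex ^ 3" where
  "fermat_law u v = vector
    [u$1 ^ 2 * v$2 * v$3 - v$1 ^ 2 * u$2 * u$3,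
     u$3 ^ 2 * v$1 * v$2 - v$3 ^ 2 * u$1 * u$2,
     u$2 ^ 2 * v$1 * v$3 - v$2 ^ 2 * u$1 * u$3]"

text \<open>The vector \<open>w\<close> represents the sum of the points \<open>u\<close> and \<open>v\<close>.  A law that vanishes at \<open>u\<close>, \<open>v\<close>
is parallel to everything and imposes no condition; asking for all three translates of the
condition makes the relation meaningful at every pair of points and visibly invariant under
translation by \<open>rot\<close>.\<close>

definition fermat_sum :: "complex ^ 3 \<Rightarrow> complex ^ 3 \<Rightarrow> complex ^ 3 \<Rightarrow> bool" where
  "fermat_sum u v w \<longleftrightarrow> w \<noteq> 0 \<and> par w (fermat_law u v) \<and>
    par (rot w) (fermat_law (rot u) v) \<and> par (rot (rot w)) (fermat_law (rot (rot u)) v)"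

lemma rot_nth [simp]: "rot v $ 1 = v$2" "rot v $ 2 = v$3" "rot v $ 3 = v$1"
  by (simp_all add: rot_def)

lemma fermat_law_nth [simp]:
  "fermat_law u v $ 1 = u$1 ^ 2 * v$2 * v$3 - v$1 ^ 2 * u$2 * u$3"
  "fermat_law u v $ 2 = u$3 ^ 2 * v$1 * v$2 - v$3 ^ 2 * u$1 * u$2"
  "fermat_law u v $ 3 = u$2 ^ 2 * v$1 * v$3 - v$2 ^ 2 * u$1 * u$3"
  by (simp_all add: fermat_law_def)

lemma rot_rot_rot [simp]: "rot (rot (rot v)) = v"
  by (simp add: vec3_eq_iff)

lemma rot_eq_0_iff [simp]: "rot v = 0 \<longleftrightarrow> v = 0"
  by (auto simp: vec3_eq_iff)

lemma rot_smult: "rot (k *s v) = k *s rot v"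
  by (simp add: vec3_eq_iff)

lemma fermat_point_rot [simp]: "fermat_point (rot v) \<longleftrightarrow> fermat_point v"
  by (auto simp: fermat_point_def algebra_simps)

lemma par_rot [simp]: "par (rot v) (rot w) \<longleftrightarrow> par v w"
  by (auto simp: par_def)

lemma fermat_law_rot_rot: "fermat_law (rot u) (rot v) = rot (rot (fermat_law u v))"
  by (simp add: vec3_eq_iff)

lemma fermat_law_smult_left: "fermat_law (k *s u) v = k ^ 2 *s fermat_law u v"
  by (simp add: vec3_eq_iff power_mult_distrib power2_eq_square algebra_simps)

lemma fermat_law_commute: "fermat_law v u = - fermat_law u v"
  by (simp add: vec3_eq_iff)

lemma fermat_law_smult_right: "fermat_law u (k *s v) = k ^ 2 *s fermat_law u v"
  by (simp add: vec3_eq_iff power_mult_distrib power2_eq_square algebra_simps)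

lemma par_uminus [simp]: "par v (- w) \<longleftrightarrow> par v w"
  by (auto simp: par_def)

text \<open>As \<open>rot\<close> is the translation by a point \<open>t\<close>, this is \<open>(u + t) + v = (u + v) + t\<close>.\<close>

lemma fermat_law_rot_par:
  assumes "fermat_point u" "fermat_point v"
  shows "par (rot (fermat_law u v)) (fermat_law (rot u) v)"
proof -
  have *: "u$1 ^ 3 + u$2 ^ 3 + u$3 ^ 3 = 0" "v$1 ^ 3 + v$2 ^ 3 + v$3 ^ 3 = 0"
    using assms by (auto simp: fermat_point_def)
  show ?thesis
    unfolding par_def rot_nth fermat_law_nth using * by (intro conjI; algebra)
qed

lemma fermat_point_law:
  assumes "fermat_point u" "fermat_point v" "fermat_law u v \<noteq> 0"
  shows "fermat_point (fermat_law u v)"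
proof -
  have *: "u$1 ^ 3 + u$2 ^ 3 + u$3 ^ 3 = 0" "v$1 ^ 3 + v$2 ^ 3 + v$3 ^ 3 = 0"
    using assms by (auto simp: fermat_point_def)
  show ?thesis
    unfolding fermat_point_def fermat_law_nth using * by (intro conjI assms(3)) algebra
qed

text \<open>Associativity at all triples where the laws involved do not vanish.  The cross products of the two
iterated sums lie in the ideal generated by the three cubic equations.\<close>

lemma fermat_law_law_par:
  assumes "fermat_point u" "fermat_point v" "fermat_point w"
  shows "par (fermat_law (fermat_law u v) w) (fermat_law u (fermat_law v w))"
proof -
  have *: "u$1 ^ 3 + u$2 ^ 3 + u$3 ^ 3 = 0" "v$1 ^ 3 + v$2 ^ 3 + v$3 ^ 3 = 0"
     "w$1 ^ 3 + w$2 ^ 3 + w$3 ^ 3 = 0"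
    using assms by (auto simp: fermat_point_def)
  show ?thesis
    unfolding par_def fermat_law_nth using * by (intro conjI; algebra)
qed

text \<open>If both laws vanish, multiplying their components with one another shows that the cubes of any
two coordinates of \<open>u\<close> agree unless the product of two coordinates of \<open>v\<close> is zero.  Three equal
cubes with sum zero are all zero.  A point \<open>v\<close> with a vanishing coordinate has only one, and
then the remaining equations force \<open>u = 0\<close>.\<close>

lemma fermat_law_exceptional:
  assumes "fermat_point u" "fermat_point v" "fermat_law u v = 0"
  shows "fermat_law (rot u) v \<noteq> 0"
proof
  assume 0: "fermat_law (rot u) v = 0"
  obtain a b c where abc: "a = u$1" "b = u$2" "c = u$3" by blast
  obtain x y z where xyz: "x = v$1" "y = v$2" "z = v$3" by blast
  note [simp] = abc[symmetric] xyz[symmetric]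
  have u: "a ^ 3 + b ^ 3 + c ^ 3 = 0" "\<not> (a = 0 \<and> b = 0 \<and> c = 0)"
    and v: "x ^ 3 + y ^ 3 + z ^ 3 = 0" "\<not> (x = 0 \<and> y = 0 \<and> z = 0)"
    using assms(1,2) by (auto simp: fermat_point_def vec3_eq_iff)
  have 1: "a ^ 2 * y * z = x ^ 2 * b * c" "c ^ 2 * x * y = z ^ 2 * a * b" "b ^ 2 * x * z = y ^ 2 * a * c"
    using assms(3) by (auto simp: vec3_eq_iff)
  have 2: "b ^ 2 * y * z = x ^ 2 * c * a" "a ^ 2 * x * y = z ^ 2 * b * c" "c ^ 2 * x * z = y ^ 2 * b * a"
    using 0 by (auto simp: vec3_eq_iff)
  have yz: "(a ^ 3 - b ^ 3) * (y * z) = 0" using 1 2 by algebra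
  have xy: "(c ^ 3 - a ^ 3) * (x * y) = 0" using 1 2 by algebra
  have xz: "(b ^ 3 - c ^ 3) * (x * z) = 0" using 1 2 by algebra
  show False
  proof (cases "x * y * z = 0")
    case False
    then have "a ^ 3 = b ^ 3" "b ^ 3 = c ^ 3" using yz xz by auto
    then have "3 * a ^ 3 = 0" using u(1) by simp
    then show False using u \<open>a ^ 3 = b ^ 3\<close> \<open>b ^ 3 = c ^ 3\<close> by simp
  next
    case True
    then consider "x = 0" "y \<noteq> 0" "z \<noteq> 0" | "y = 0" "x \<noteq> 0" "z \<noteq> 0" | "z = 0" "x \<noteq> 0" "y \<noteq> 0"
      using v by (cases "x = 0"; cases "y = 0"; cases "z = 0") auto
    then show False using 1 2 u by cases auto
  qed
qed

lemma fermat_sum_rot: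
  "fermat_sum (rot u) v (rot w) \<longleftrightarrow> fermat_sum u v w"
  by (auto simp: fermat_sum_def)

lemma fermat_law_rot_par2:
  assumes "fermat_point u" "fermat_point v"
  shows "par (rot (rot (fermat_law u v))) (fermat_law (rot (rot u)) v)"
proof -
  have "par (rot (fermat_law (rot (rot u)) v)) (fermat_law u v)"
    using fermat_law_rot_par[of "rot (rot u)" v] assms by simp
  then have "par (fermat_law u v) (rot (fermat_law (rot (rot u)) v))" by (rule par_sym)
  then show ?thesis using par_rot[of "rot (fermat_law u v)" "rot (rot (fermat_law (rot (rot u)) v))"]
    by simp
qed

lemma fermat_sum_law:
  assumes "fermat_point u" "fermat_point v" "fermat_law u v \<noteq> 0"
  shows "fermat_sum u v (fermat_law u v)"
  using assms fermat_law_rot_par fermat_law_rot_par2 by (simp add: fermat_sum_def par_refl)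

lemma fermat_sum_smult:
  assumes "fermat_sum u v w" "k \<noteq> 0"
  shows "fermat_sum (k *s u) v w" "fermat_sum u (k *s v) w" "fermat_sum u v (k *s w)"
  using assms
  by (auto simp: fermat_sum_def rot_smult fermat_law_smult_left fermat_law_smult_right par_def)

lemma fermat_sum_exists:
  assumes "fermat_point u" "fermat_point v"
  shows "\<exists>w. fermat_point w \<and> fermat_sum u v w"
proof (cases "fermat_law u v = 0")
  case False
  then show ?thesis using fermat_sum_law fermat_point_law assms by blast
next
  case True
  let ?w = "fermat_law (rot u) v"
  have w: "?w \<noteq> 0" using fermat_law_exceptional True assms by blast
  then have "fermat_sum (rot u) v (rot (rot (rot ?w)))"
    using fermat_sum_law[of "rot u" v] assms by simp
  then have "fermat_sum u v (rot (rot ?w))" unfolding fermat_sum_rot .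
  moreover have "fermat_point (rot (rot ?w))" using fermat_point_law[of "rot u" v] w assms by simp
  ultimately show ?thesis by blast
qed

lemma fermat_sum_unique:
  assumes "fermat_point u" "fermat_point v" "fermat_sum u v w" "fermat_sum u v w'"
  shows "par w w'"
proof (cases "fermat_law u v = 0")
  case False
  then show ?thesis using assms by (meson fermat_sum_def par_sym par_trans)
next
  case True
  then have "fermat_law (rot u) v \<noteq> 0" using fermat_law_exceptional assms by blast
  then have "par (rot w) (rot w')" using assms by (meson fermat_sum_def par_sym par_trans)
  then show ?thesis by simp
qed

lemma fermat_sum_par:
  assumes "fermat_sum u v w" "par w w'" "w' \<noteq> 0"
  shows "fermat_sum u v w'"
proof -
  have "w \<noteq> 0" using assms(1) by (simp add: fermat_sum_def)
  then obtain k where "k \<noteq> 0" "w' = k *s w" using assms par_iff_multiple by blast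
  then show ?thesis using fermat_sum_smult assms by blast
qed

lemma fermat_sum_fermat_point:
  assumes "fermat_point u" "fermat_point v" "fermat_sum u v w"
  shows "fermat_point w"
proof -
  obtain w' where w': "fermat_point w'" "fermat_sum u v w'" using fermat_sum_exists assms by blast
  then have "par w' w" using fermat_sum_unique assms by blast
  then obtain k where "k \<noteq> 0" "w = k *s w'"
    using par_iff_multiple w' assms by (metis fermat_sum_def)
  then show ?thesis using w'
    by (simp add: fermat_point_def power_mult_distrib flip: distrib_left)
qed

text \<open>The law is antisymmetric.  Exchanging the arguments also exchanges the two translated laws, as
permuting both arguments turns \<open>fermat_law u (rot v)\<close> into \<open>fermat_law (rot (rot u)) v\<close>.\<close>

lemma fermat_sum_commute:
  assumes "fermat_sum u v w"
  shows "fermat_sum v u w"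
proof -
  have 1: "fermat_law (rot v) u = - rot (rot (fermat_law (rot (rot u)) v))"
    using fermat_law_rot_rot[of v "rot (rot u)"] fermat_law_commute[of v "rot (rot u)"]
    by (simp add: vec3_eq_iff)
  have 2: "fermat_law (rot (rot v)) u = - rot (fermat_law (rot u) v)"
    using fermat_law_rot_rot[of v "rot u"] fermat_law_rot_rot[of "rot v" "rot (rot u)"] 
      fermat_law_commute[of v "rot u"]
    by (simp add: vec3_eq_iff)
  have "par (rot (rot (rot (rot w)))) (rot (rot (fermat_law (rot (rot u)) v)))"
    using assms unfolding par_rot fermat_sum_def by simp
  moreover have "par (rot (rot w)) (rot (fermat_law (rot u) v))"
    using assms unfolding par_rot fermat_sum_def by simp
  ultimately show ?thesis using assms
    by (simp add: fermat_sum_def 1 2 fermat_law_commute[of v u])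
qed

lemma fermat_sum_rot_right: "fermat_sum u (rot v) (rot w) \<longleftrightarrow> fermat_sum u v w"
  using fermat_sum_commute fermat_sum_rot by blast

lemma fermat_sum_rot_pow:
  "fermat_sum ((rot ^^ i) u) ((rot ^^ j) v) ((rot ^^ (i + j)) w) \<longleftrightarrow> fermat_sum u v w"
proof (induction i)
  case 0
  show ?case by (induction j) (simp_all add: fermat_sum_rot_right)
qed (simp_all add: fermat_sum_rot)

lemma fermat_sum_assoc_generic:
  assumes "fermat_point u" "fermat_point v" "fermat_point w"
    and "fermat_sum u v p" "fermat_sum p w x" "fermat_sum v w q" "fermat_sum u q y"
    and "fermat_law u v \<noteq> 0" "fermat_law p w \<noteq> 0" "fermat_law v w \<noteq> 0" "fermat_law u q \<noteq> 0"
  shows "par x y"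
proof -
  have "par (fermat_law u v) p" "par (fermat_law v w) q"
    using assms(4,6) by (auto simp: fermat_sum_def intro: par_sym)
  then obtain k l where "p = k *s fermat_law u v" "q = l *s fermat_law v w"
    using par_imp_multiple assms(8,10) by metis
  then have p: "fermat_law p w = k ^ 2 *s fermat_law (fermat_law u v) w"
    and q: "fermat_law u q = l ^ 2 *s fermat_law u (fermat_law v w)"
    by (simp_all add: fermat_law_smult_left fermat_law_smult_right)
  have nz: "fermat_law (fermat_law u v) w \<noteq> 0" "fermat_law u (fermat_law v w) \<noteq> 0" "k \<noteq> 0" "l \<noteq> 0"
    using assms(9,11) p q by auto
  have "par x (fermat_law p w)" "par y (fermat_law u q)"
    using assms(5,7) by (simp_all add: fermat_sum_def)
  then have "par x (fermat_law (fermat_law u v) w)" "par y (fermat_law u (fermat_law v w))"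
    using nz(3,4) by (auto simp: p q par_def)
  then show ?thesis
    using fermat_law_law_par[OF assms(1-3)] nz par_sym par_trans by meson
qed

lemma fermat_law_rot_right:
  "fermat_law u (rot v) = rot (rot (fermat_law (rot (rot u)) v))"
  by (simp add: fermat_law_rot_rot flip: fermat_law_rot_rot[of "rot (rot u)" v])

lemma fermat_law_two_of_three:
  assumes "fermat_point u" "fermat_point v"
  shows "fermat_law u v \<noteq> 0 \<or> fermat_law (rot u) v \<noteq> 0"
    and "fermat_law (rot u) v \<noteq> 0 \<or> fermat_law (rot (rot u)) v \<noteq> 0"
    and "fermat_law (rot (rot u)) v \<noteq> 0 \<or> fermat_law u v \<noteq> 0"
  using fermat_law_exceptional[of u v] fermat_law_exceptional[of "rot u" v]
    fermat_law_exceptional[of "rot (rot u)" v] assms by auto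

lemma par_rot_pow: "par ((rot ^^ n) v) ((rot ^^ n) w) \<longleftrightarrow> par v w"
  by (induction n) simp_all

lemma fermat_point_rot_pow: "fermat_point ((rot ^^ n) v) \<longleftrightarrow> fermat_point v"
  by (induction n) simp_all

text \<open>Translating \<open>u\<close> by \<open>a\<close> steps and \<open>w\<close> by \<open>c\<close> steps moves both triple sums by \<open>a + c\<close> steps, so it
suffices to choose \<open>a\<close> and \<open>c\<close> such that none of the four laws involved vanishes.  These laws
depend on \<open>a\<close>, on \<open>c\<close>, and twice on \<open>a - c\<close> modulo 3, and each of them excludes at most one
residue.  Hence some value of \<open>a - c\<close> is allowed, and for it at least one of the three choices
of \<open>a\<close> is.\<close>

lemma fermat_sum_assoc:
  assumes "fermat_point u" "fermat_point v" "fermat_point w"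
    and "fermat_sum u v p" "fermat_sum p w x" "fermat_sum v w q" "fermat_sum u q y"
  shows "par x y"
proof -
  have pq: "fermat_point p" "fermat_point q"
    using fermat_sum_fermat_point assms by blast+
  note two = fermat_law_two_of_three[OF assms(1,2)] fermat_law_two_of_three[OF assms(2,3)]
    fermat_law_two_of_three[OF pq(1) assms(3)] fermat_law_two_of_three[OF assms(1) pq(2)]
  have "\<exists>a\<in>{0,1,2}. \<exists>c\<in>{0,1,2}. fermat_law ((rot ^^ a) u) v \<noteq> 0 \<and>
      fermat_law v ((rot ^^ c) w) \<noteq> 0 \<and> fermat_law ((rot ^^ a) p) ((rot ^^ c) w) \<noteq> 0 \<and>
      fermat_law ((rot ^^ a) u) ((rot ^^ c) q) \<noteq> 0"
    using two by (simp add: numeral_2_eq_2 fermat_law_rot_right) argo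
  then obtain a c where ac: "fermat_law ((rot ^^ a) u) v \<noteq> 0"
    "fermat_law v ((rot ^^ c) w) \<noteq> 0" "fermat_law ((rot ^^ a) p) ((rot ^^ c) w) \<noteq> 0"
    "fermat_law ((rot ^^ a) u) ((rot ^^ c) q) \<noteq> 0" by blast
  have "par ((rot ^^ (a + c)) x) ((rot ^^ (a + c)) y)"
    using assms(4-7) fermat_sum_rot_pow[of a u 0 v p] fermat_sum_rot_pow[of a p c w x]
      fermat_sum_rot_pow[of 0 v c w q] fermat_sum_rot_pow[of a u c q y]
    by (intro fermat_sum_assoc_generic[OF _ assms(2) _ _ _ _ _ ac(1,3,2,4)])
      (simp_all add: fermat_point_rot_pow assms(1,3))
  then show ?thesis by (simp add: par_rot_pow)
qed

lemma fermat_sum_neutral: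
  assumes "fermat_point v"
  shows "fermat_sum (vector [0, 1, -1]) v v"
  using assms by (simp add: fermat_sum_def par_def fermat_point_def power2_eq_square algebra_simps)

lemma fermat_sum_negative:
  "fermat_sum v (vector [v$1, v$3, v$2]) (vector [0, 1, -1])"
  by (simp add: fermat_sum_def par_def power2_eq_square algebra_simps vec3_eq_iff)

section \<open>Points of projective spaces and of the curve\<close>

lemma proj_rel_refl: "(v :: complex ^ 'n) \<noteq> 0 \<Longrightarrow> v \<noteq> 0 \<and> v \<noteq> 0 \<and> (\<exists>k. k \<noteq> 0 \<and> v = k *s v)"
  by (auto intro!: exI[of _ 1])

lemma abs_proj_eq_iff:
  assumes "v \<noteq> 0" "w \<noteq> 0"
  shows "abs_proj v = abs_proj w \<longleftrightarrow> (\<exists>k. k \<noteq> 0 \<and> w = k *s v)"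
  using Quotient3_rel[OF Quotient3_proj, of v w] assms proj_rel_refl by blast

lemma abs_proj_smult:
  fixes v :: "complex ^ 'n::finite"
  assumes "v \<noteq> 0" "k \<noteq> 0"
  shows "abs_proj (k *s v) = abs_proj v"
  using abs_proj_eq_iff[of v "k *s v"] assms by auto

lemma proj_exhaust: 
  obtains v where "v \<noteq> 0" "p = abs_proj v"
  by (induction p) auto

lemma coord_ratio_abs_proj: "v \<noteq> 0 \<Longrightarrow> coord_ratio i j (abs_proj v) = v$i / v$j"
  using coord_ratio.abs_eq[OF proj_rel_refl] .

lemma abs_proj_eq_iff_par:
  "v \<noteq> 0 \<Longrightarrow> w \<noteq> 0 \<Longrightarrow> abs_proj v = abs_proj w \<longleftrightarrow> par v w"
  by (simp add: abs_proj_eq_iff par_iff_multiple)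

lemma vector3_eq_0_iff [simp]: "(vector [a, b, c] :: complex ^ 3) = 0 \<longleftrightarrow> a = 0 \<and> b = 0 \<and> c = 0"
  by (simp add: vec3_eq_iff)

lemma aff_pt_coords [simp]: "zeta_coord (aff_pt x y) = x" "eta_coord (aff_pt x y) = y"
  by (simp_all add: aff_pt_def coord_ratio_abs_proj)

lemma aff_pt_eq_iff [simp]: "aff_pt x y = aff_pt x' y' \<longleftrightarrow> x = x' \<and> y = y'"
  by (metis aff_pt_coords)

lemma aff_pt_neq_inf [simp]: "aff_pt x y \<noteq> inf_pt" "inf_pt \<noteq> aff_pt x y"
  by (auto simp: aff_pt_def inf_pt_def abs_proj_eq_iff vec3_eq_iff)

lemma aff_pt_in_curve [simp]: "aff_pt x y \<in> curve c \<longleftrightarrow> y ^ 2 = x ^ 3 + c"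
  by (auto simp: curve_def)

lemma inf_pt_in_curve [simp]: "inf_pt \<in> curve c"
  by (simp add: curve_def)

lemma curve_cases:
  assumes "u \<in> curve c"
  obtains "u = inf_pt" | x y where "u = aff_pt x y" "y ^ 2 = x ^ 3 + c"
  using assms by (auto simp: curve_def)

lemma abs_proj_affine:
  assumes "v$3 \<noteq> 0"
  shows "abs_proj v = aff_pt (v$1 / v$3) (v$2 / v$3)"
proof -
  have "v = v$3 *s vector [v$1 / v$3, v$2 / v$3, 1]" using assms by (simp add: vec3_eq_iff)
  then have "abs_proj v = abs_proj (v$3 *s vector [v$1 / v$3, v$2 / v$3, 1])" by simp
  then show ?thesis using assms by (subst (asm) abs_proj_smult) (simp_all add: aff_pt_def)
qed

lemma abs_proj_in_curve_iff:
  assumes "v \<noteq> 0"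
  shows "abs_proj v \<in> curve c \<longleftrightarrow> v$2 ^ 2 * v$3 = v$1 ^ 3 + c * v$3 ^ 3"
proof (cases "v$3 = 0")
  case True
  have "abs_proj v \<noteq> aff_pt x y" for x y
    using True assms by (auto simp: aff_pt_def abs_proj_eq_iff vec3_eq_iff)
  moreover have "abs_proj v = inf_pt \<longleftrightarrow> v$1 = 0"
    using True assms by (auto simp: inf_pt_def abs_proj_eq_iff vec3_eq_iff intro!: exI[of _ "1 / v$2"])
  ultimately show ?thesis using True by (auto simp: curve_def)
next
  case False
  then show ?thesis by (simp add: abs_proj_affine field_simps power2_eq_square power3_eq_cube)
qed

lemma par_multiple: "par v (a *s v)"
  by (simp add: par_def)

lemma fermat_law_self: "fermat_law v v = 0"
  by (simp add: vec3_eq_iff)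

section \<open>Chord-tangent addition as Fermat addition\<close>

text \<open>The constants of the coordinate change from the curve to the Fermat cubic.  With
\<open>U = r Z + Y\<close> and \<open>V = r Z - Y\<close> one has \<open>U ^ 3 + V ^ 3 = 2 r Z (r ^ 2 Z ^ 2 + 3 Y ^ 2)\<close>, which for
\<open>r ^ 2 = - 3 c\<close> equals \<open>6 r (Y ^ 2 Z - c Z ^ 3)\<close>, hence \<open>6 r X ^ 3\<close> on the curve; \<open>k\<close> absorbs
the factor.\<close>

locale fermat_model =
  fixes c r k :: complex
  assumes c_nonzero: "c \<noteq> 0" and r_square: "r ^ 2 = - 3 * c" and k_cube: "k ^ 3 = - 6 * r"
begin

lemma r_nonzero: "r \<noteq> 0" and k_nonzero: "k \<noteq> 0"
  using c_nonzero r_square k_cube by auto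

definition to_fermat :: "complex ^ 3 \<Rightarrow> complex ^ 3" where
  "to_fermat v = vector [k * v$1, r * v$3 + v$2, r * v$3 - v$2]"

definition of_fermat :: "complex ^ 3 \<Rightarrow> complex ^ 3" where
  "of_fermat w = vector [w$1 / k, (w$2 - w$3) / 2, (w$2 + w$3) / (2 * r)]"

lemma to_fermat_nth [simp]:
  "to_fermat v $ 1 = k * v$1" "to_fermat v $ 2 = r * v$3 + v$2" "to_fermat v $ 3 = r * v$3 - v$2"
  by (simp_all add: to_fermat_def)

lemma of_fermat_nth [simp]:
  "of_fermat w $ 1 = w$1 / k" "of_fermat w $ 2 = (w$2 - w$3) / 2"
  "of_fermat w $ 3 = (w$2 + w$3) / (2 * r)"
  by (simp_all add: of_fermat_def)

lemma to_of_fermat [simp]: "to_fermat (of_fermat w) = w"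
  using r_nonzero k_nonzero by (simp add: vec3_eq_iff field_simps)

lemma of_to_fermat [simp]: "of_fermat (to_fermat v) = v"
  using r_nonzero k_nonzero by (simp add: vec3_eq_iff field_simps)

lemma to_fermat_smult: "to_fermat (a *s v) = a *s to_fermat v"
  by (simp add: vec3_eq_iff algebra_simps)

lemma of_fermat_smult: "of_fermat (a *s v) = a *s of_fermat v"
  by (simp add: vec3_eq_iff algebra_simps add_divide_distrib diff_divide_distrib)

lemma to_fermat_eq_0_iff [simp]: "to_fermat v = 0 \<longleftrightarrow> v = 0"
proof
  assume "to_fermat v = 0"
  then have "of_fermat (to_fermat v) = of_fermat 0" by simp
  then show "v = 0" by (simp add: vec3_eq_iff)
qed (simp add: vec3_eq_iff)

lemma of_fermat_eq_0_iff [simp]: "of_fermat w = 0 \<longleftrightarrow> w = 0"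
  using to_fermat_eq_0_iff[of "of_fermat w"] by simp

lemma fermat_point_to_fermat:
  "fermat_point (to_fermat v) \<longleftrightarrow> v \<noteq> 0 \<and> abs_proj v \<in> curve c"
proof -
  have "(to_fermat v)$1 ^ 3 + (to_fermat v)$2 ^ 3 + (to_fermat v)$3 ^ 3 =
      6 * r * (v$2 ^ 2 * v$3 - (v$1 ^ 3 + c * v$3 ^ 3))"
    unfolding to_fermat_nth using r_square k_cube by algebra
  then show ?thesis using r_nonzero by (auto simp: fermat_point_def abs_proj_in_curve_iff)
qed

lemma par_to_fermat: "par v w \<Longrightarrow> par (to_fermat v) (to_fermat w)"
  unfolding par_def to_fermat_nth by algebra

lemma par_of_fermat: 
  assumes "par v w" shows "par (of_fermat v) (of_fermat w)"
proof (cases "v = 0")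
  case False
  then obtain a where "w = a *s v" using par_imp_multiple assms by blast
  then show ?thesis by (simp add: of_fermat_smult par_multiple)
qed (simp add: par_def)

definition curve_sum :: "complex ^ 3 \<Rightarrow> complex ^ 3 \<Rightarrow> complex ^ 3 \<Rightarrow> bool" where
  "curve_sum u v w \<longleftrightarrow> fermat_sum (to_fermat u) (to_fermat v) (to_fermat w)"

lemma curve_sum_smult:
  assumes "a \<noteq> 0" "curve_sum u v w"
  shows "curve_sum (a *s u) v w" "curve_sum u (a *s v) w" "curve_sum u v (a *s w)"
  using assms fermat_sum_smult by (auto simp: curve_sum_def to_fermat_smult)

text \<open>The coordinates of the third point have denominator \<open>(x2 - x1) ^ 3\<close>.  After multiplication by it,
being parallel to each of the three laws is a polynomial identity modulo the equations of the two
points and of the two constants of the model.\<close>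

lemma curve_sum_chord:
  assumes curve: "y1 ^ 2 = x1 ^ 3 + c" "y2 ^ 2 = x2 ^ 3 + c" and "x1 \<noteq> x2"
    and l: "l = (y2 - y1) / (x2 - x1)"
  shows "curve_sum (vector [x1, y1, 1]) (vector [x2, y2, 1])
    (vector [l ^ 2 - x1 - x2, l * (x1 - (l ^ 2 - x1 - x2)) - y1, 1])"
proof -
  define d where "d = x2 - x1"
  define e where "e = y2 - y1"
  define x3 where "x3 = (e ^ 2 - (x1 + x2) * d ^ 2) * d"
  define y3 where "y3 = e * (x1 * d ^ 2 - (e ^ 2 - (x1 + x2) * d ^ 2)) - y1 * d ^ 3"
  have d: "d \<noteq> 0" using assms(3) by (simp add: d_def)
  have law0: "par (to_fermat (vector [x3, y3, d ^ 3]))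
    (fermat_law (to_fermat (vector [x1, y1, 1])) (to_fermat (vector [x2, y2, 1])))"
    unfolding par_def fermat_law_nth to_fermat_nth vector_3 x3_def y3_def d_def e_def
    using curve r_square k_cube by (intro conjI; algebra)
  have law1: "par (rot (to_fermat (vector [x3, y3, d ^ 3])))
    (fermat_law (rot (to_fermat (vector [x1, y1, 1]))) (to_fermat (vector [x2, y2, 1])))"
    unfolding par_def fermat_law_nth to_fermat_nth rot_nth vector_3 x3_def y3_def d_def e_def
    using curve r_square k_cube by (intro conjI; algebra)
  have law2: "par (rot (rot (to_fermat (vector [x3, y3, d ^ 3]))))
    (fermat_law (rot (rot (to_fermat (vector [x1, y1, 1])))) (to_fermat (vector [x2, y2, 1])))"
    unfolding par_def fermat_law_nth to_fermat_nth rot_nth vector_3 x3_def y3_def d_def e_def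
    using curve r_square k_cube by (intro conjI; algebra)
  have "curve_sum (vector [x1, y1, 1]) (vector [x2, y2, 1]) (vector [x3, y3, d ^ 3])"
    using law0 law1 law2 d by (simp add: curve_sum_def fermat_sum_def)
  then have "curve_sum (vector [x1, y1, 1]) (vector [x2, y2, 1])
      ((1 / d ^ 3) *s vector [x3, y3, d ^ 3])"
    using d by (intro curve_sum_smult) simp_all
  also have "(1 / d ^ 3) *s vector [x3, y3, d ^ 3] =
      (vector [l ^ 2 - x1 - x2, l * (x1 - (l ^ 2 - x1 - x2)) - y1, 1] :: complex ^ 3)"
    using d unfolding vec3_eq_iff l x3_def y3_def d_def[symmetric] e_def[symmetric]
    by (simp add: field_simps power2_eq_square power3_eq_cube)
  finally show ?thesis .
qed

text \<open>The point at which the tangent meets the curve again has coordinates with denominator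
\<open>(2 * y) ^ 3\<close>.  Here the untranslated law vanishes, and the doubling is determined by its
translates.\<close>

lemma curve_sum_tangent:
  assumes curve: "y ^ 2 = x ^ 3 + c" and "y \<noteq> 0" and l: "l = 3 * x ^ 2 / (2 * y)"
  shows "curve_sum (vector [x, y, 1]) (vector [x, y, 1])
    (vector [l ^ 2 - x - x, l * (x - (l ^ 2 - x - x)) - y, 1])"
proof -
  define d where "d = 2 * y"
  define e where "e = 3 * x ^ 2"
  define x3 where "x3 = (e ^ 2 - (x + x) * d ^ 2) * d"
  define y3 where "y3 = e * (x * d ^ 2 - (e ^ 2 - (x + x) * d ^ 2)) - y * d ^ 3"
  have d: "d \<noteq> 0" using assms(2) by (simp add: d_def)
  have law0: "par (to_fermat (vector [x3, y3, d ^ 3]))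
    (fermat_law (to_fermat (vector [x, y, 1])) (to_fermat (vector [x, y, 1])))"
    by (simp add: fermat_law_self par_def)
  have law1: "par (rot (to_fermat (vector [x3, y3, d ^ 3])))
    (fermat_law (rot (to_fermat (vector [x, y, 1]))) (to_fermat (vector [x, y, 1])))"
    unfolding par_def fermat_law_nth to_fermat_nth rot_nth vector_3 x3_def y3_def d_def e_def
    using curve r_square k_cube by (intro conjI; algebra)
  have law2: "par (rot (rot (to_fermat (vector [x3, y3, d ^ 3]))))
    (fermat_law (rot (rot (to_fermat (vector [x, y, 1])))) (to_fermat (vector [x, y, 1])))"
    unfolding par_def fermat_law_nth to_fermat_nth rot_nth vector_3 x3_def y3_def d_def e_def
    using curve r_square k_cube by (intro conjI; algebra)
  have "curve_sum (vector [x, y, 1]) (vector [x, y, 1]) (vector [x3, y3, d ^ 3])"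
    using law0 law1 law2 d by (simp add: curve_sum_def fermat_sum_def)
  then have "curve_sum (vector [x, y, 1]) (vector [x, y, 1])
      ((1 / d ^ 3) *s vector [x3, y3, d ^ 3])"
    using d by (intro curve_sum_smult) simp_all
  also have "(1 / d ^ 3) *s vector [x3, y3, d ^ 3] =
      (vector [l ^ 2 - x - x, l * (x - (l ^ 2 - x - x)) - y, 1] :: complex ^ 3)"
    using d unfolding vec3_eq_iff l x3_def y3_def d_def[symmetric] e_def[symmetric]
    by (simp add: field_simps power2_eq_square power3_eq_cube)
  finally show ?thesis .
qed

lemma to_fermat_infinity: "to_fermat (vector [0, 1, 0]) = vector [0, 1, -1]"
  by (simp add: vec3_eq_iff)

lemma curve_sum_infinity:
  assumes "v \<noteq> 0" "abs_proj v \<in> curve c"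
  shows "curve_sum (vector [0, 1, 0]) v v" "curve_sum v (vector [0, 1, 0]) v"
  using fermat_sum_neutral fermat_sum_commute assms
  by (simp_all add: curve_sum_def to_fermat_infinity fermat_point_to_fermat)

lemma curve_sum_opposite: "curve_sum v (vector [v$1, - v$2, v$3]) (vector [0, 1, 0])"
proof -
  have "to_fermat (vector [v$1, - v$2, v$3]) = vector [k * v$1, r * v$3 - v$2, r * v$3 + v$2]"
    by (simp add: vec3_eq_iff)
  then show ?thesis using fermat_sum_negative[of "to_fermat v"]
    by (simp add: curve_sum_def to_fermat_infinity)
qed

text \<open>The chord-tangent rule is stated in affine coordinates, so the comparison with the law on the
Fermat cubic is made for these representatives.\<close>

lemma normalized_representative:
  assumes "u \<noteq> 0" "abs_proj u \<in> curve c"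
  obtains a where "a \<noteq> 0" "u = a *s vector [0, 1, 0]"
  | a x y where "a \<noteq> 0" "u = a *s vector [x, y, 1]" "y ^ 2 = x ^ 3 + c"
  using assms(2)
proof (cases rule: curve_cases)
  case 1
  then show thesis using that(1) assms(1)
    by (metis abs_proj_eq_iff inf_pt_def vector3_eq_0_iff zero_neq_one)
next
  case (2 x y)
  then show thesis using that(2) assms(1)
    by (metis abs_proj_eq_iff aff_pt_def vector3_eq_0_iff zero_neq_one)
qed

lemma curve_add_affine:
  assumes "y1 ^ 2 = x1 ^ 3 + c" "y2 ^ 2 = x2 ^ 3 + c"
  shows "\<exists>w. w \<noteq> 0 \<and> curve_add (aff_pt x1 y1) (aff_pt x2 y2) = abs_proj w \<and>
    curve_sum (vector [x1, y1, 1]) (vector [x2, y2, 1]) w"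
proof -
  consider "x1 = x2" "y1 = - y2" | "x1 = x2" "y1 \<noteq> - y2" | "x1 \<noteq> x2" by blast
  then show ?thesis
  proof cases
    case 1
    then have "curve_add (aff_pt x1 y1) (aff_pt x2 y2) = abs_proj (vector [0, 1, 0])"
      by (simp add: curve_add_def inf_pt_def[symmetric])
    moreover have "curve_sum (vector [x1, y1, 1]) (vector [x2, y2, 1]) (vector [0, 1, 0])"
      using curve_sum_opposite[of "vector [x1, y1, 1]"] 1 by simp
    ultimately show ?thesis by (intro exI[of _ "vector [0, 1, 0]"]) simp
  next
    case 2
    have "(y1 - y2) * (y1 + y2) = 0" using assms 2(1) by algebra
    then have y: "y2 = y1" "y1 \<noteq> 0" using 2(2) by (auto simp: add_eq_0_iff)
    define l where "l = 3 * x1 ^ 2 / (2 * y1)"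
    have "curve_add (aff_pt x1 y1) (aff_pt x2 y2) =
        abs_proj (vector [l ^ 2 - x1 - x1, l * (x1 - (l ^ 2 - x1 - x1)) - y1, 1])"
      using 2 y by (simp add: curve_add_def Let_def l_def aff_pt_def[symmetric])
    then show ?thesis using curve_sum_tangent[OF assms(1) y(2) l_def] 2(1) y(1)
      by (intro exI conjI) auto
  next
    case 3
    define l where "l = (y2 - y1) / (x2 - x1)"
    have "curve_add (aff_pt x1 y1) (aff_pt x2 y2) =
        abs_proj (vector [l ^ 2 - x1 - x2, l * (x1 - (l ^ 2 - x1 - x2)) - y1, 1])"
      using 3 by (simp add: curve_add_def Let_def l_def aff_pt_def[symmetric])
    then show ?thesis using curve_sum_chord[OF assms 3 l_def]
      by (intro exI conjI) auto
  qed
qed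

lemma curve_add_curve_sum_exists:
  assumes "u \<noteq> 0" "abs_proj u \<in> curve c" "v \<noteq> 0" "abs_proj v \<in> curve c"
  shows "\<exists>w. w \<noteq> 0 \<and> curve_add (abs_proj u) (abs_proj v) = abs_proj w \<and> curve_sum u v w"
  using assms(1,2)
proof (cases rule: normalized_representative)
  case (1 a)
  then have "curve_add (abs_proj u) (abs_proj v) = abs_proj v"
    by (simp add: curve_add_def abs_proj_smult flip: inf_pt_def)
  then show ?thesis using 1 curve_sum_infinity(1)[OF assms(3,4)] assms(3) curve_sum_smult(1) by blast
next
  case u: (2 a x1 y1)
  from assms(3,4) show ?thesis
  proof (cases rule: normalized_representative)
    case (1 a)
    then have "curve_add (abs_proj u) (abs_proj v) = abs_proj u"
      by (simp add: curve_add_def abs_proj_smult flip: inf_pt_def)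
    then show ?thesis using 1 curve_sum_infinity(2)[OF assms(1,2)] assms(1) curve_sum_smult(2) by blast
  next
    case v: (2 b x2 y2)
    obtain w where w: "w \<noteq> 0" "curve_add (aff_pt x1 y1) (aff_pt x2 y2) = abs_proj w"
      "curve_sum (vector [x1, y1, 1]) (vector [x2, y2, 1]) w"
      using curve_add_affine u(3) v(3) by blast
    then have "curve_sum u v w" using u v curve_sum_smult by blast
    moreover have "abs_proj u = aff_pt x1 y1" "abs_proj v = aff_pt x2 y2"
      using u v by (simp_all add: aff_pt_def abs_proj_smult)
    ultimately show ?thesis using w by auto
  qed
qed

lemma curve_add_eq_iff:
  assumes "u \<noteq> 0" "abs_proj u \<in> curve c" "v \<noteq> 0" "abs_proj v \<in> curve c" "w \<noteq> 0"
  shows "curve_add (abs_proj u) (abs_proj v) = abs_proj w \<longleftrightarrow> curve_sum u v w"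
proof -
  have uv: "fermat_point (to_fermat u)" "fermat_point (to_fermat v)"
    using assms by (simp_all add: fermat_point_to_fermat)
  obtain w' where w': "w' \<noteq> 0" "curve_add (abs_proj u) (abs_proj v) = abs_proj w'" "curve_sum u v w'"
    using curve_add_curve_sum_exists assms by blast
  have "par w' w \<longleftrightarrow> curve_sum u v w"
  proof
    assume "par w' w"
    then show "curve_sum u v w"
      using w' assms(5) fermat_sum_par par_to_fermat by (auto simp: curve_sum_def)
  next
    assume "curve_sum u v w"
    then have "par (to_fermat w') (to_fermat w)"
      using w' uv fermat_sum_unique by (auto simp: curve_sum_def)
    then show "par w' w" using par_of_fermat by fastforce
  qed
  then show ?thesis using w' assms(5) by (simp add: abs_proj_eq_iff_par)
qed

lemma curve_add_closed:
  assumes "p \<in> curve c" "q \<in> curve c"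
  shows "curve_add p q \<in> curve c"
proof -
  obtain u v where uv: "u \<noteq> 0" "p = abs_proj u" "v \<noteq> 0" "q = abs_proj v" by (metis proj_exhaust)
  obtain w where w: "w \<noteq> 0" "curve_add p q = abs_proj w" "curve_sum u v w"
    using curve_add_curve_sum_exists assms uv by blast
  then have "fermat_point (to_fermat w)"
    using fermat_sum_fermat_point[of "to_fermat u" "to_fermat v" "to_fermat w"] assms uv
    by (auto simp: curve_sum_def fermat_point_to_fermat)
  then show ?thesis using w by (simp add: fermat_point_to_fermat)
qed

lemma curve_add_assoc:
  assumes "p \<in> curve c" "q \<in> curve c" "s \<in> curve c"
  shows "curve_add (curve_add p q) s = curve_add p (curve_add q s)"
proof -
  obtain u v w where uvw: "u \<noteq> 0" "p = abs_proj u" "v \<noteq> 0" "q = abs_proj v" "w \<noteq> 0" "s = abs_proj w"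
    by (metis proj_exhaust)
  obtain m where m: "m \<noteq> 0" "curve_add p q = abs_proj m" by (metis proj_exhaust)
  obtain n where n: "n \<noteq> 0" "curve_add q s = abs_proj n" by (metis proj_exhaust)
  obtain x where x: "x \<noteq> 0" "curve_add (curve_add p q) s = abs_proj x" by (metis proj_exhaust)
  obtain y where y: "y \<noteq> 0" "curve_add p (curve_add q s) = abs_proj y" by (metis proj_exhaust)
  have closed: "abs_proj m \<in> curve c" "abs_proj n \<in> curve c"
    using m n curve_add_closed assms by metis+
  have "curve_sum u v m" "curve_sum v w n" "curve_sum m w x" "curve_sum u n y"
    using m n x y uvw closed assms curve_add_eq_iff by auto
  then have "par (to_fermat x) (to_fermat y)"
    using fermat_sum_assoc[of "to_fermat u" "to_fermat v" "to_fermat w"] uvw assms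
    by (auto simp: curve_sum_def fermat_point_to_fermat)
  then have "par x y" using par_of_fermat by fastforce
  then show ?thesis using x y by (simp add: abs_proj_eq_iff_par)
qed

end

section \<open>Zeros of binary forms\<close>

lemma CP1_pt_eq_iff:
  assumes "(a, b) \<noteq> (0, 0)" "(a', b') \<noteq> (0, 0)"
  shows "CP1_pt a b = CP1_pt a' b' \<longleftrightarrow> a * b' = a' * b"
proof -
  have nz: "vector [a, b] \<noteq> (0 :: complex ^ 2)" "vector [a', b'] \<noteq> (0 :: complex ^ 2)"
    using assms by (auto simp: vec_eq_iff forall_2)
  have "(\<exists>k. k \<noteq> 0 \<and> a' = k * a \<and> b' = k * b) \<longleftrightarrow> a * b' = a' * b"
  proof
    assume *: "a * b' = a' * b"
    show "\<exists>k. k \<noteq> 0 \<and> a' = k * a \<and> b' = k * b"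
    proof (cases "a = 0")
      case True
      then show ?thesis using * assms by (intro exI[of _ "b' / b"]) auto
    next
      case False
      then show ?thesis using * assms by (intro exI[of _ "a' / a"]) (auto simp: field_simps)
    qed
  qed auto
  then show ?thesis unfolding CP1_pt_def abs_proj_eq_iff[OF nz] by (simp add: vec_eq_iff forall_2)
qed

lemma CP1_exhaust:
  obtains a b where "(a, b) \<noteq> (0, 0)" "p = CP1_pt a b"
proof -
  obtain v where v: "v \<noteq> 0" "p = abs_proj v" by (rule proj_exhaust)
  moreover have "v = vector [v$1, v$2]" by (simp add: vec_eq_iff forall_2)
  moreover have "(v$1, v$2) \<noteq> (0, 0)" using v by (auto simp: vec_eq_iff forall_2)
  ultimately show thesis using that[of "v$1" "v$2"] by (simp add: CP1_pt_def)
qed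

text \<open>A factor with \<open>b = 0\<close> is a nonzero constant; it has no affine zero and leaves a degree deficit,
which is what counts the zeros at infinity.\<close>

lemma zeros_of_linear_factors:
  fixes L :: "(complex \<times> complex) list"
  assumes "(0, 0) \<notin> set L"
  defines "q \<equiv> (\<Prod>(a, b)\<leftarrow>L. [: - a, b :])"
  shows "q \<noteq> 0 \<and> degree q \<le> length L \<and>
    image_mset of_complex (proots q) + replicate_mset (length L - degree q) CP1_inf =
      mset (map (\<lambda>(a, b). CP1_pt a b) L)"
  using assms(1) unfolding q_def
proof (induction L)
  case Nil
  show ?case by simp
next
  case (Cons ab L)
  obtain a b where ab: "ab = (a, b)" by fastforce
  define q where "q = (\<Prod>(a, b)\<leftarrow>L. [: - a, b :])"
  have IH: "q \<noteq> 0" "degree q \<le> length L"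
    "image_mset of_complex (proots q) + replicate_mset (length L - degree q) CP1_inf =
      mset (map (\<lambda>(a, b). CP1_pt a b) L)"
    using Cons unfolding q_def by auto
  have prod: "(\<Prod>(a, b)\<leftarrow>ab # L. [: - a, b :]) = [: - a, b :] * q"
    by (simp add: ab q_def)
  show ?case
  proof (cases "b = 0")
    case True
    then have "a \<noteq> 0" using Cons.prems ab by auto
    have "CP1_pt a 0 = CP1_inf"
      using \<open>a \<noteq> 0\<close> by (simp add: CP1_inf_def CP1_pt_eq_iff)
    then show ?thesis unfolding prod using True IH \<open>a \<noteq> 0\<close> Cons.prems
      by (simp add: ab Suc_diff_le)
  next
    case False
    have lin: "[: - a, b :] = smult b [: - (a / b), 1 :]" using False by simp
    have "CP1_pt a b = of_complex (a / b)"
      using False by (simp add: of_complex_def CP1_pt_eq_iff)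
    moreover have "proots [: - a, b :] = {# a / b #}"
      unfolding lin using False by (subst proots_smult) simp_all
    then have "proots ([: - a, b :] * q) = {# a / b #} + proots q"
      using IH False by (subst proots_mult) simp_all
    moreover have "degree ([: - a, b :] * q) = Suc (degree q)"
      using False IH by (subst degree_mult_eq) auto
    moreover have "[: - a, b :] * q \<noteq> 0"
      using False IH by (subst mult_eq_0_iff) simp
    ultimately show ?thesis unfolding prod using IH by (simp add: ab del: mult_pCons_left)
  qed
qed

lemma form_zeros_linear_factors:
  assumes "length L = n" "(0, 0) \<notin> set L" "\<kappa> \<noteq> 0"
    and "\<And>z. (\<Sum>i\<le>n. b i * z ^ i) = \<kappa> * (\<Prod>(x1, x0)\<leftarrow>L. z * x0 - x1)"
  shows "form_zeros n b = mset (map (\<lambda>(x1, x0). CP1_pt x1 x0) L)" and "\<exists>i\<le>n. b i \<noteq> 0"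
proof -
  define q where "q = (\<Prod>(a, b)\<leftarrow>L. [: - a, b :])"
  have "poly (\<Sum>i\<le>n. monom (b i) i) z = poly (smult \<kappa> q) z" for z
  proof -
    have "poly q z = (\<Prod>(x1, x0)\<leftarrow>L. z * x0 - x1)"
      unfolding q_def by (induction L) auto
    then show ?thesis using assms(4)[of z] by (simp add: poly_sum poly_monom)
  qed
  then have eq: "(\<Sum>i\<le>n. monom (b i) i) = smult \<kappa> q" by (simp add: poly_eq_poly_eq_iff[symmetric] fun_eq_iff)
  have q: "q \<noteq> 0" "image_mset of_complex (proots q) + replicate_mset (length L - degree q) CP1_inf =
      mset (map (\<lambda>(a, b). CP1_pt a b) L)"
    using zeros_of_linear_factors[OF assms(2)] by (simp_all add: q_def)
  show "form_zeros n b = mset (map (\<lambda>(x1, x0). CP1_pt x1 x0) L)"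
    unfolding form_zeros_def Let_def eq using assms(1,3) q by simp
  show "\<exists>i\<le>n. b i \<noteq> 0"
  proof (rule ccontr)
    assume "\<not> ?thesis"
    then have "(\<Sum>i\<le>n. monom (b i) i) = 0" by simp
    then show False using eq assms(3) q by simp
  qed
qed

section \<open>The cubic form of the three-valued law\<close>

text \<open>The form \<open>f (w ^ k * X2)\<close> is linear in \<open>U\<close> and \<open>V\<close> and vanishes at the image of \<open>u + \<phi> ^ k v\<close> in the
\<open>(U : V)\<close>-line, where \<open>\<phi>\<close> multiplies the first coordinate by the cube root of unity \<open>w\<close>; it comes
from the law plus \<open>t\<close> times one of its translates.  The product over \<open>k\<close> is the norm
\<open>d ^ 3 + x ^ 3 b ^ 3 + x ^ 6 a ^ 3 - 3 x ^ 3 a b d\<close>, so it only contains cubes of \<open>X2\<close>, which the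
equation of the curve eliminates.  What remains is the cubic form of the three-valued law times
a factor free of \<open>U\<close> and \<open>V\<close>, which measures where the laws used vanish.\<close>

lemma norm_form_factorization:
  fixes X1 U1 V1 X2 U2 V2 U V t :: complex
  assumes "X1 ^ 3 + U1 ^ 3 + V1 ^ 3 = 0" "X2 ^ 3 + U2 ^ 3 + V2 ^ 3 = 0" "w ^ 3 = 1" "w \<noteq> 1"
  defines "f \<equiv> (\<lambda>x. x ^ 2 * (t * X1 * V1 * V) +
      x * (U * U1 ^ 2 * V2 - V * V1 ^ 2 * U2 + t * X1 ^ 2 * U2 * U) -
      X1 * (U * U2 ^ 2 * V1 - V * V2 ^ 2 * U1) - t * (U * V2 ^ 2 * U1 * V1 + V * U1 ^ 2 * U2 * V2))"
  shows "f X2 * f (w * X2) * f (w ^ 2 * X2) =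
   ((U * V1 * V2 + V * U1 * U2) ^ 3 - (U1 ^ 3 + V1 ^ 3) * (U2 ^ 3 + V2 ^ 3) * (U ^ 3 + V ^ 3)) *
   (U1 ^ 3 * V2 ^ 3 - U2 ^ 3 * V1 ^ 3 + 3 * t * U1 * U2 * V2 ^ 2 * X1 ^ 2 -
      3 * t ^ 2 * U1 ^ 2 * U2 ^ 2 * V2 * X1 +
      t ^ 3 * (U1 ^ 3 * U2 ^ 3 + U2 ^ 3 * V1 ^ 3 + V1 ^ 3 * V2 ^ 3))"
proof -
  have "(w - 1) * (1 + w + w ^ 2) = 0" using assms(3) by algebra
  then have w: "1 + w + w ^ 2 = 0" using assms(4) by simp
  have norm: "(x ^ 2 * a + x * b + d) * ((w * x) ^ 2 * a + (w * x) * b + d) *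
      ((w ^ 2 * x) ^ 2 * a + (w ^ 2 * x) * b + d) =
      d ^ 3 + x ^ 3 * b ^ 3 + x ^ 6 * a ^ 3 - 3 * x ^ 3 * d * b * a" for x a b d
    using w by algebra
  have f: "f x = x ^ 2 * (t * X1 * V1 * V) +
      x * (U * U1 ^ 2 * V2 - V * V1 ^ 2 * U2 + t * X1 ^ 2 * U2 * U) +
      (- X1 * (U * U2 ^ 2 * V1 - V * V2 ^ 2 * U1) - t * (U * V2 ^ 2 * U1 * V1 + V * U1 ^ 2 * U2 * V2))" for x
    by (simp add: f_def)
  show ?thesis unfolding f norm using assms(1,2) by algebra
qed

text \<open>The coefficient of \<open>z ^ i * x ^ j * y ^ k\<close> in \<open>p3 c z (- x) (- y)\<close>: one line for each \<open>i\<close>, one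
inner list for each \<open>j\<close>.\<close>

definition p3_coeff :: "complex \<Rightarrow> nat \<Rightarrow> nat \<Rightarrow> nat \<Rightarrow> complex" where
  "p3_coeff c i j k =
   [[[0, 0, 0, -1], [0, 0, -3, 0], [0, -3, 0, 0], [-1, 0, 0, 0]],
    [[0, 0, 3, 0], [0, -21, 0, 18 * c], [3, 0, -18 * c, 0], [0, 18 * c, 0, -27 * c ^ 2]],
    [[0, -3, 0, 0], [-3, 0, 18 * c, 0], [0, 18 * c, 0, -27 * c ^ 2], [0, 0, -27 * c ^ 2, 0]],
    [[1, 0, 0, 0], [0, 18 * c, 0, -27 * c ^ 2], [0, 0, 27 * c ^ 2, 0], [0, -27 * c ^ 2, 0, 0]]]
    ! i ! j ! k"

text \<open>The coefficients of the binary cubic form in \<open>(z1 : z0)\<close> whose zeros are the product of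
\<open>(x1 : x0)\<close> and \<open>(y1 : y0)\<close>.\<close>

definition p3_form :: "complex \<Rightarrow> complex \<Rightarrow> complex \<Rightarrow> complex \<Rightarrow> complex \<Rightarrow> nat \<Rightarrow> complex" where
  "p3_form c x1 x0 y1 y0 i =
    (\<Sum>j\<le>3. \<Sum>k\<le>3. p3_coeff c i j k * x1 ^ j * x0 ^ (3 - j) * y1 ^ k * y0 ^ (3 - k))"

lemma atMost_3: "{..3::nat} = {0, 1, 2, 3}"
  by auto

lemma p3_coeff_polynomial:
  "p3 c z (- x) (- y) = (\<Sum>i\<le>3. \<Sum>j\<le>3. \<Sum>k\<le>3. p3_coeff c i j k * z ^ i * x ^ j * y ^ k)"
  by (simp add: atMost_3 p3_coeff_def p3_def Let_def) algebra

lemma p3_coeff_commute: "i \<le> 3 \<Longrightarrow> j \<le> 3 \<Longrightarrow> k \<le> 3 \<Longrightarrow> p3_coeff c i j k = p3_coeff c i k j"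
  unfolding atMost_iff[symmetric] atMost_3 by (auto simp: p3_coeff_def)

lemma p3_form_commute: "i \<le> 3 \<Longrightarrow> p3_form c x1 x0 y1 y0 i = p3_form c y1 y0 x1 x0 i"
  unfolding p3_form_def by (subst sum.swap) (auto intro!: sum.cong simp: p3_coeff_commute)

lemma exists_avoiding_roots:
  fixes a b :: "'i \<Rightarrow> complex"
  assumes "finite J" "\<And>j. j \<in> J \<Longrightarrow> (a j, b j) \<noteq> (0, 0)"
  shows "\<exists>t. \<forall>j\<in>J. a j + t * b j \<noteq> 0"
proof -
  have "(\<Prod>j\<in>J. [: a j, b j :]) \<noteq> 0" using assms by (auto simp: prod_zero_iff)
  then obtain t where "poly (\<Prod>j\<in>J. [: a j, b j :]) t \<noteq> 0" by (metis poly_all_0_iff_0)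
  then show ?thesis using assms(1) by (auto simp: poly_prod prod_zero_iff)
qed

lemma exists_avoiding_zero_vectors:
  fixes a b :: "'i \<Rightarrow> complex ^ 'n"
  assumes "finite J" "\<And>j. j \<in> J \<Longrightarrow> a j \<noteq> 0 \<or> b j \<noteq> 0"
  shows "\<exists>t. \<forall>j\<in>J. a j + t *s b j \<noteq> 0"
proof -
  have "\<exists>m. (a j $ m, b j $ m) \<noteq> (0, 0)" if "j \<in> J" for j
    using assms(2)[OF that] by (auto simp: vec_eq_iff)
  then obtain m where m: "\<And>j. j \<in> J \<Longrightarrow> (a j $ m j, b j $ m j) \<noteq> (0, 0)" by metis
  obtain t where "\<forall>j\<in>J. a j $ m j + t * b j $ m j \<noteq> 0"
    using exists_avoiding_roots[of J "\<lambda>j. a j $ m j" "\<lambda>j. b j $ m j"] assms(1) m by blast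
  then have "\<forall>j\<in>J. (a j + t *s b j) $ m j \<noteq> 0" by simp
  then show ?thesis by (metis zero_index)
qed

context fermat_model
begin

text \<open>One has \<open>p3 = (\<sigma>1 - 3 c \<sigma>3) ^ 3 - 27 \<sigma>3 (1 - c x ^ 2) (1 - c y ^ 2) (1 - c z ^ 2)\<close>.  With
\<open>c = - r ^ 2 / 3\<close>, twice \<open>r (\<sigma>1 - 3 c \<sigma>3)\<close> is the difference of the products of the \<open>1 + r x\<close> and
of the \<open>1 - r x\<close>, and \<open>6 r x (1 - c x ^ 2) = (1 + r x) ^ 3 - (1 - r x) ^ 3\<close>.  Thus \<open>p3\<close> becomes the
cubic form of the Fermat cubic in the coordinates \<open>U = r x1 + x0\<close> and \<open>V = r x1 - x0\<close>; the change of
sign of \<open>x\<close> and \<open>y\<close> exchanges \<open>U\<close> and \<open>V\<close> in these arguments.\<close>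

lemma p3_form_fermat:
  "8 * r ^ 3 * (\<Sum>i\<le>3. p3_form c x1 x0 y1 y0 i * z ^ i) =
    ((r * z + 1) * (r * x1 - x0) * (r * y1 - y0) + (r * z - 1) * (r * x1 + x0) * (r * y1 + y0)) ^ 3 -
    ((r * x1 + x0) ^ 3 + (r * x1 - x0) ^ 3) * ((r * y1 + y0) ^ 3 + (r * y1 - y0) ^ 3) *
    ((r * z + 1) ^ 3 + (r * z - 1) ^ 3)"
  using r_square by (simp add: atMost_3 p3_form_def p3_coeff_def) algebra

text \<open>The zeros of the form have to be identified with multiplicity, so it is not enough that each of
the three points is a zero.  Instead the form is shown to be, up to a nonzero constant, the
product of the linear forms vanishing at these points.\<close>

lemma form_zeros_p3_form:
  assumes w: "w ^ 3 = 1" "w \<noteq> 1"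
    and u: "u \<noteq> 0" "abs_proj u \<in> curve c" and v: "v \<noteq> 0" "abs_proj v \<in> curve c"
    and s: "\<And>j. j < 3 \<Longrightarrow> curve_sum u (vector [w ^ j * v$1, v$2, v$3]) (s j)"
  shows "form_zeros 3 (p3_form c (u$3) (u$2) (v$3) (v$2)) =
      {# CP1_pt (s 0 $ 3) (s 0 $ 2), CP1_pt (s 1 $ 3) (s 1 $ 2), CP1_pt (s 2 $ 3) (s 2 $ 2) #}"
    and "\<exists>i\<le>3. p3_form c (u$3) (u$2) (v$3) (v$2) i \<noteq> 0"
proof -
  define P where "P = to_fermat u"
  define Q where "Q = (\<lambda>j. to_fermat (vector [w ^ j * v$1, v$2, v$3]))"
  have Q_nth: "Q j $ 1 = w ^ j * Q 0 $ 1" "Q j $ 2 = Q 0 $ 2" "Q j $ 3 = Q 0 $ 3" for j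
    by (simp_all add: Q_def)
  have wj: "(w ^ j) ^ 3 = 1" for j
    using w(1) by (metis power_commutes power_mult power_one mult.commute)
  have P: "fermat_point P" using u by (simp add: P_def fermat_point_to_fermat)
  have Q0: "fermat_point (Q 0)"
  proof -
    have "vector [v$1, v$2, v$3] = v" by (simp add: vec3_eq_iff)
    then show ?thesis using v by (simp add: Q_def fermat_point_to_fermat)
  qed
  have Q: "fermat_point (Q j)" for j
  proof -
    have "w \<noteq> 0" using w(1) by auto
    then have "Q j \<noteq> 0" using Q0 by (auto simp: fermat_point_def vec3_eq_iff Q_nth[of j])
    then show ?thesis
      using Q0 unfolding fermat_point_def Q_nth[of j] by (simp add: power_mult_distrib wj)
  qed
  have sum: "fermat_sum P (Q j) (to_fermat (s j))" if "j < 3" for j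
    using s[OF that] by (simp add: curve_sum_def P_def Q_def)
  have s_point: "s j \<noteq> 0" "abs_proj (s j) \<in> curve c" if "j < 3" for j
    using fermat_sum_fermat_point[OF P Q sum[OF that]] by (auto simp: fermat_point_to_fermat)
  have s_nz: "(s j $ 3, s j $ 2) \<noteq> (0, 0)" if "j < 3" for j
    using s_point[OF that] by (auto simp: abs_proj_in_curve_iff vec3_eq_iff)
  \<comment> \<open>The law plus \<open>t\<close> times a translate still represents the sum if it does not vanish, and a single
    \<open>t\<close> can be chosen for all three summands.  No single translate would do: there are \<open>u\<close> and \<open>v\<close>
    such that each of the three laws vanishes at one of the pairs.\<close>
  define law where "law = (\<lambda>t j. fermat_law P (Q j) + t *s rot (rot (fermat_law (rot P) (Q j))))"
  have "\<exists>t. \<forall>j\<in>{..<3}. law t j \<noteq> 0"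
    unfolding law_def using fermat_law_two_of_three(1)[OF P Q]
    by (intro exists_avoiding_zero_vectors) auto
  then obtain t where t: "\<And>j. j < 3 \<Longrightarrow> law t j \<noteq> 0" by auto
  have "\<exists>m. m \<noteq> 0 \<and> law t j = m *s to_fermat (s j)" if "j < 3" for j
  proof -
    have "par (to_fermat (s j)) (fermat_law P (Q j))"
      "par (rot (to_fermat (s j))) (fermat_law (rot P) (Q j))"
      using sum[OF that] by (simp_all add: fermat_sum_def)
    then have "par (to_fermat (s j)) (rot (rot (fermat_law (rot P) (Q j))))"
      using par_rot[of "to_fermat (s j)" "rot (rot (fermat_law (rot P) (Q j)))"] by simp
    then have "par (to_fermat (s j)) (law t j)"
      using \<open>par (to_fermat (s j)) (fermat_law P (Q j))\<close>
      unfolding law_def par_def vector_add_component vector_smult_component by algebra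
    then show ?thesis using t[OF that] s_point[OF that] par_iff_multiple by auto
  qed
  then obtain m where m: "\<And>j. j < 3 \<Longrightarrow> m j \<noteq> 0" "\<And>j. j < 3 \<Longrightarrow> law t j = m j *s to_fermat (s j)"
    by metis
  \<comment> \<open>The linear form with coefficients taken from the law vanishes at the sum; by the norm identity the
    product of the three is a multiple of the cubic form.\<close>
  obtain G where G: "\<And>U V. (U * law t 0 $ 3 - V * law t 0 $ 2) * (U * law t 1 $ 3 - V * law t 1 $ 2) *
      (U * law t 2 $ 3 - V * law t 2 $ 2) =
      ((U * P$3 * Q 0 $ 3 + V * P$2 * Q 0 $ 2) ^ 3 -
        (P$2 ^ 3 + P$3 ^ 3) * (Q 0 $ 2 ^ 3 + Q 0 $ 3 ^ 3) * (U ^ 3 + V ^ 3)) * G"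
  proof (rule that)
    fix U V
    have PQ: "P$1 ^ 3 + P$2 ^ 3 + P$3 ^ 3 = 0" "Q 0 $ 1 ^ 3 + Q 0 $ 2 ^ 3 + Q 0 $ 3 ^ 3 = 0"
      using P Q0 by (simp_all add: fermat_point_def)
    have form: "U * law t j $ 3 - V * law t j $ 2 = (w ^ j * Q 0 $ 1) ^ 2 * (t * P$1 * P$3 * V) +
      (w ^ j * Q 0 $ 1) * (U * P$2 ^ 2 * Q 0 $ 3 - V * P$3 ^ 2 * Q 0 $ 2 + t * P$1 ^ 2 * Q 0 $ 2 * U) -
      P$1 * (U * Q 0 $ 2 ^ 2 * P$3 - V * Q 0 $ 3 ^ 2 * P$2) -
      t * (U * Q 0 $ 3 ^ 2 * P$2 * P$3 + V * P$2 ^ 2 * Q 0 $ 2 * Q 0 $ 3)" for j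
      by (simp add: law_def Q_nth[of j] algebra_simps)
    show "(U * law t 0 $ 3 - V * law t 0 $ 2) * (U * law t 1 $ 3 - V * law t 1 $ 2) *
      (U * law t 2 $ 3 - V * law t 2 $ 2) =
      ((U * P$3 * Q 0 $ 3 + V * P$2 * Q 0 $ 2) ^ 3 -
        (P$2 ^ 3 + P$3 ^ 3) * (Q 0 $ 2 ^ 3 + Q 0 $ 3 ^ 3) * (U ^ 3 + V ^ 3)) *
      (P$2 ^ 3 * Q 0 $ 3 ^ 3 - Q 0 $ 2 ^ 3 * P$3 ^ 3 + 3 * t * P$2 * Q 0 $ 2 * Q 0 $ 3 ^ 2 * P$1 ^ 2 -
      3 * t ^ 2 * P$2 ^ 2 * Q 0 $ 2 ^ 2 * Q 0 $ 3 * P$1 +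
      t ^ 3 * (P$2 ^ 3 * Q 0 $ 2 ^ 3 + Q 0 $ 2 ^ 3 * P$3 ^ 3 + P$3 ^ 3 * Q 0 $ 3 ^ 3))"
      unfolding form using norm_form_factorization[OF PQ w, of t V U] by simp
  qed
  let ?b = "p3_form c (u$3) (u$2) (v$3) (v$2)"
  \<comment> \<open>In the coordinates \<open>U = r * z + 1\<close>, \<open>V = r * z - 1\<close> of the point \<open>(z : 1)\<close> this is the linear form
    with zero \<open>(s j $ 3 : s j $ 2)\<close>.\<close>
  have factor: "(r * z + 1) * law t j $ 3 - (r * z - 1) * law t j $ 2 =
      - 2 * r * m j * (z * s j $ 2 - s j $ 3)" if "j < 3" for z j
    unfolding m(2)[OF that] by (simp add: algebra_simps)
  have key: "G * (\<Sum>i\<le>3. ?b i * z ^ i) = - (m 0 * m 1 * m 2) *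
      ((z * s 0 $ 2 - s 0 $ 3) * (z * s 1 $ 2 - s 1 $ 3) * (z * s 2 $ 2 - s 2 $ 3))" for z
  proof -
    have less: "0 < (3::nat)" "1 < (3::nat)" "2 < (3::nat)" by simp_all
    let ?a0 = "z * s 0 $ 2 - s 0 $ 3" and ?a1 = "z * s 1 $ 2 - s 1 $ 3" and ?a2 = "z * s 2 $ 2 - s 2 $ 3"
    have rescale: "(- 2 * r * m0 * a0) * (- 2 * r * m1 * a1) * (- 2 * r * m2 * a2) =
        (8 * r ^ 3) * (- (m0 * m1 * m2) * (a0 * a1 * a2))" for m0 m1 m2 a0 a1 a2 :: complex
      by algebra
    have "(8 * r ^ 3) * (G * (\<Sum>i\<le>3. ?b i * z ^ i)) = (8 * r ^ 3 * (\<Sum>i\<le>3. ?b i * z ^ i)) * G"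
      by (simp only: mult_ac)
    also have "\<dots> = (- 2 * r * m 0 * ?a0) * (- 2 * r * m 1 * ?a1) * (- 2 * r * m 2 * ?a2)"
      using G[of "r * z + 1" "r * z - 1"]
      unfolding factor[OF less(1)] factor[OF less(2)] factor[OF less(3)] p3_form_fermat
        P_def Q_def to_fermat_nth vector_3 by (simp add: mult_ac)
    also have "\<dots> = (8 * r ^ 3) * (- (m 0 * m 1 * m 2) * (?a0 * ?a1 * ?a2))"
      by (rule rescale)
    finally have "(8 * r ^ 3) * (G * (\<Sum>i\<le>3. ?b i * z ^ i)) =
        (8 * r ^ 3) * (- (m 0 * m 1 * m 2) * (?a0 * ?a1 * ?a2))" .
    moreover have "8 * r ^ 3 \<noteq> 0" using r_nonzero by simp
    ultimately show ?thesis by (rule mult_left_cancel[THEN iffD1, rotated])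
  qed
  \<comment> \<open>Otherwise the product of three nonzero linear forms would vanish identically.\<close>
  have "G \<noteq> 0"
  proof
    assume "G = 0"
    obtain z where "\<forall>j\<in>{..<3}. - s j $ 3 + z * s j $ 2 \<noteq> 0"
      using exists_avoiding_roots[of "{..<3}" "\<lambda>j. - s j $ 3" "\<lambda>j. s j $ 2"] s_nz by auto
    then have "z * s j $ 2 - s j $ 3 \<noteq> 0" if "j < 3" for j using that by (auto simp: algebra_simps)
    then show False using key[of z] m(1) \<open>G = 0\<close> by simp
  qed
  define L where "L = [(s 0 $ 3, s 0 $ 2), (s 1 $ 3, s 1 $ 2), (s 2 $ 3, s 2 $ 2)]"
  have L: "length L = 3" "(0, 0) \<notin> set L" "- (m 0 * m 1 * m 2) / G \<noteq> 0"
    "(\<Sum>i\<le>3. ?b i * z ^ i) = - (m 0 * m 1 * m 2) / G * (\<Prod>(x1, x0)\<leftarrow>L. z * x0 - x1)" for z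
    using s_nz[of 0] s_nz[of 1] s_nz[of 2] m(1) \<open>G \<noteq> 0\<close> key[of z] by (auto simp: L_def field_simps)
  show "form_zeros 3 ?b =
      {# CP1_pt (s 0 $ 3) (s 0 $ 2), CP1_pt (s 1 $ 3) (s 1 $ 2), CP1_pt (s 2 $ 3) (s 2 $ 2) #}"
    using form_zeros_linear_factors(1)[OF L] by (simp add: L_def)
  show "\<exists>i\<le>3. ?b i \<noteq> 0"
    using form_zeros_linear_factors(2)[OF L] .
qed

end

section \<open>Regular maps and diagonal transformations\<close>

text \<open>The action of diagonal matrices.  Unless all entries are nonzero the matrix may kill a vector, and
the map is taken to be the identity, so that it is defined on the whole projective space.\<close>

lift_definition diag_act :: "complex ^ 'n \<Rightarrow> 'n::finite proj \<Rightarrow> 'n proj"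
  is "\<lambda>d v. if \<forall>i. d$i \<noteq> 0 then \<chi> i. d$i * v$i else v"
  by (auto simp: vec_eq_iff)

lemma diag_act_abs_proj:
  assumes "\<forall>i. d$i \<noteq> 0" "v \<noteq> 0"
  shows "diag_act d (abs_proj v) = abs_proj (\<chi> i. d$i * v$i)"
  using diag_act.abs_eq[OF proj_rel_refl, OF assms(2), of d] assms(1) by simp

lemma diag_act_diag_act:
  assumes "\<forall>i. d$i \<noteq> 0" "\<forall>i. d'$i \<noteq> 0"
  shows "diag_act d (diag_act d' p) = diag_act (\<chi> i. d$i * d'$i) p"
proof -
  obtain v where v: "v \<noteq> 0" "p = abs_proj v" by (rule proj_exhaust)
  then have "(\<chi> i. d'$i * v$i) \<noteq> 0" using assms by (auto simp: vec_eq_iff)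
  then show ?thesis using v assms by (simp add: diag_act_abs_proj mult.assoc)
qed

lemma diag_act_1: "diag_act (\<chi> i. 1) p = p"
proof -
  obtain v where v: "v \<noteq> 0" "p = abs_proj v" by (rule proj_exhaust)
  then show ?thesis by (simp add: diag_act_abs_proj)
qed

lemma hom_poly_cmult: "hom_poly d F \<Longrightarrow> hom_poly d (\<lambda>v. a * F v)"
  using hom_poly.mult[OF hom_poly.const] by simp

lemma hom_poly_coord: "hom_poly 1 (\<lambda>v. a * v$i)"
  by (rule hom_poly_cmult[OF hom_poly.coord])

lemma hom_poly_power: "hom_poly d F \<Longrightarrow> hom_poly (n * d) (\<lambda>v. F v ^ n)"
  by (induction n) (use hom_poly.const[of 1] in \<open>auto intro: hom_poly.mult\<close>)

lemma bihom_poly_cmult: "bihom_poly d e F \<Longrightarrow> bihom_poly d e (\<lambda>v w. a * F v w)"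
  using bihom_poly.mult[OF bihom_poly.const] by simp

lemma bihom_poly_divide: "bihom_poly d e F \<Longrightarrow> bihom_poly d e (\<lambda>v w. F v w / a)"
  using bihom_poly_cmult[of d e F "1 / a"] by simp

lemma bihom_poly_diff:
  "bihom_poly d e F \<Longrightarrow> bihom_poly d e G \<Longrightarrow> bihom_poly d e (\<lambda>v w. F v w - G v w)"
  using bihom_poly.add[OF _ bihom_poly_cmult[of d e G "-1"]] by simp

lemma bihom_poly_power: "bihom_poly d e F \<Longrightarrow> bihom_poly (n * d) (n * e) (\<lambda>v w. F v w ^ n)"
  by (induction n) (use bihom_poly.const[of 1] in \<open>auto intro: bihom_poly.mult\<close>)

lemma bihom_poly_sum:
  assumes "finite A" "A \<noteq> {}" "\<And>i. i \<in> A \<Longrightarrow> bihom_poly d e (F i)"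
  shows "bihom_poly d e (\<lambda>v w. \<Sum>i\<in>A. F i v w)"
  using assms by (induction A rule: finite_ne_induct) (auto intro: bihom_poly.add)

lemma regular_map_cong:
  assumes "regular_map S f" "\<And>p. p \<in> S \<Longrightarrow> f p = g p"
  shows "regular_map S g"
  unfolding regular_map_def
proof (intro allI impI)
  fix v0 assume "v0 \<noteq> 0 \<and> abs_proj v0 \<in> S"
  then obtain d F where F: "\<forall>i. hom_poly d (F i)" "(\<chi> i. F i v0) \<noteq> 0"
    and f: "\<forall>v. v \<noteq> 0 \<and> abs_proj v \<in> S \<and> (\<chi> i. F i v) \<noteq> 0 \<longrightarrow>
      f (abs_proj v) = abs_proj (\<chi> i. F i v)"
    using assms(1)[unfolded regular_map_def, rule_format, of v0] by blast
  have "\<forall>v. v \<noteq> 0 \<and> abs_proj v \<in> S \<and> (\<chi> i. F i v) \<noteq> 0 \<longrightarrow>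
      g (abs_proj v) = abs_proj (\<chi> i. F i v)"
    using f by (simp flip: assms(2))
  then show "\<exists>d F. (\<forall>i. hom_poly d (F i)) \<and> (\<chi> i. F i v0) \<noteq> 0 \<and>
    (\<forall>v. v \<noteq> 0 \<and> abs_proj v \<in> S \<and> (\<chi> i. F i v) \<noteq> 0 \<longrightarrow>
      g (abs_proj v) = abs_proj (\<chi> i. F i v))"
    using F by blast
qed

lemma regular_map_formula:
  assumes "\<And>i. hom_poly d (F i)"
    and "\<And>v. v \<noteq> 0 \<Longrightarrow> abs_proj v \<in> S \<Longrightarrow>
      (\<chi> i. F i v) \<noteq> 0 \<and> f (abs_proj v) = abs_proj (\<chi> i. F i v)"
  shows "regular_map S f"
  unfolding regular_map_def
proof (intro allI impI exI[of _ d] exI[of _ F] conjI)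
  fix v0 assume "v0 \<noteq> 0 \<and> abs_proj v0 \<in> S"
  then show "(\<chi> i. F i v0) \<noteq> 0" using assms(2) by blast
qed (use assms in blast)+

lemma regular_map_diag_act:
  assumes "\<forall>i. d$i \<noteq> 0"
  shows "regular_map S (diag_act d)"
proof (rule regular_map_formula)
  fix v :: "complex ^ 'a" assume "v \<noteq> 0" "abs_proj v \<in> S"
  then show "(\<chi> i. d$i * v$i) \<noteq> 0 \<and> diag_act d (abs_proj v) = abs_proj (\<chi> i. d$i * v$i)"
    using assms by (auto simp: diag_act_abs_proj vec_eq_iff)
qed (rule hom_poly_coord)

lemma biregular_diag_act:
  assumes d: "\<forall>i. d$i \<noteq> 0" and "diag_act d ` S = T" and f: "\<And>p. p \<in> S \<Longrightarrow> f p = diag_act d p"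
  shows "biregular S T f"
proof -
  define d' where "d' = (\<chi> i. 1 / d$i)"
  have d': "\<forall>i. d'$i \<noteq> 0" using d by (simp add: d'_def)
  have inv: "diag_act d' (diag_act d p) = p" for p
    using d d' by (simp add: diag_act_diag_act d'_def diag_act_1)
  have bij: "bij_betw f S T"
    using assms(2) inv f by (intro bij_betw_byWitness[where f' = "diag_act d'"]) auto
  have "inv_into S f q = diag_act d' q" if "q \<in> T" for q
  proof -
    from that obtain p where p: "p \<in> S" "q = f p" using bij by (auto simp: bij_betw_def)
    then have "inv_into S f q = p" using bij by (simp add: bij_betw_def)
    then show ?thesis using p f inv by simp
  qed
  then have "regular_map T (inv_into S f)"
    by (intro regular_map_cong[OF regular_map_diag_act[OF d']]) simp
  moreover have "regular_map S f"
    by (intro regular_map_cong[OF regular_map_diag_act[OF d]]) (simp add: f)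
  ultimately show ?thesis unfolding biregular_def using bij by blast
qed

text \<open>The map \<open>(\<zeta>, \<eta>) \<mapsto> (\<mu> \<zeta>, \<nu> \<eta>)\<close>.  When \<open>\<nu> ^ 2 = \<mu> ^ 3\<close> it maps the curve with parameter
\<open>c\<close> to the one with parameter \<open>\<nu> ^ 2 * c\<close>.  Negation, the powers of \<open>phi3\<close> and the isomorphisms
between different curves are all of this kind.\<close>

definition curve_scale :: "complex \<Rightarrow> complex \<Rightarrow> CP2 \<Rightarrow> CP2" where
  "curve_scale \<mu> \<nu> = diag_act (vector [\<mu>, \<nu>, 1])"

lemma curve_scale_abs_proj:
  assumes "\<mu> \<noteq> 0" "\<nu> \<noteq> 0" "v \<noteq> 0"
  shows "curve_scale \<mu> \<nu> (abs_proj v) = abs_proj (vector [\<mu> * v$1, \<nu> * v$2, v$3])"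
proof -
  have "(\<chi> i. (vector [\<mu>, \<nu>, 1] :: complex ^ 3) $ i * v$i) = vector [\<mu> * v$1, \<nu> * v$2, v$3]"
    by (simp add: vec3_eq_iff)
  then show ?thesis using assms by (simp add: curve_scale_def diag_act_abs_proj forall_3)
qed

lemma curve_scale_inf [simp]:
  assumes "\<mu> \<noteq> 0" "\<nu> \<noteq> 0"
  shows "curve_scale \<mu> \<nu> inf_pt = inf_pt"
  using assms unfolding inf_pt_def
  by (subst curve_scale_abs_proj) (auto simp: abs_proj_eq_iff vec3_eq_iff intro!: exI[of _ "1 / \<nu>"])

lemma curve_scale_aff [simp]:
  assumes "\<mu> \<noteq> 0" "\<nu> \<noteq> 0"
  shows "curve_scale \<mu> \<nu> (aff_pt x y) = aff_pt (\<mu> * x) (\<nu> * y)"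
  using assms unfolding aff_pt_def by (subst curve_scale_abs_proj) simp_all

lemma curve_scale_curve_scale:
  assumes "\<mu> \<noteq> 0" "\<nu> \<noteq> 0" "\<mu>' \<noteq> 0" "\<nu>' \<noteq> 0" "u \<in> curve c"
  shows "curve_scale \<mu> \<nu> (curve_scale \<mu>' \<nu>' u) = curve_scale (\<mu> * \<mu>') (\<nu> * \<nu>') u"
  using assms(5) by (cases rule: curve_cases) (use assms in auto)

lemma curve_scale_1: "u \<in> curve c \<Longrightarrow> curve_scale 1 1 u = u"
  by (erule curve_cases) auto

lemma curve_scale_in_curve:
  assumes "\<mu> \<noteq> 0" "\<nu> \<noteq> 0" "\<nu> ^ 2 = \<mu> ^ 3" "u \<in> curve c"
  shows "curve_scale \<mu> \<nu> u \<in> curve (\<nu> ^ 2 * c)"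
  using assms(4) by (cases rule: curve_cases) (use assms in \<open>auto simp: power_mult_distrib algebra_simps\<close>)

text \<open>The slope of a chord scales by \<open>\<nu> / \<mu>\<close>, and so does that of a tangent because
\<open>\<mu> ^ 2 / \<nu> = \<nu> / \<mu>\<close>.\<close>

lemma curve_scale_add:
  assumes "\<mu> \<noteq> 0" "\<nu> \<noteq> 0" "\<nu> ^ 2 = \<mu> ^ 3" "u \<in> curve c" "v \<in> curve c"
  shows "curve_add (curve_scale \<mu> \<nu> u) (curve_scale \<mu> \<nu> v) = curve_scale \<mu> \<nu> (curve_add u v)"
  using assms(4)
proof (cases rule: curve_cases)
  case u: (2 x1 y1)
  from assms(5) show ?thesis
  proof (cases rule: curve_cases)
    case v: (2 x2 y2)
    define slope where "slope = (\<lambda>x1 y1 x2 y2 :: complex.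
      if x1 = x2 then 3 * x1 ^ 2 / (2 * y1) else (y2 - y1) / (x2 - x1))"
    have slope: "slope (\<mu> * x1) (\<nu> * y1) (\<mu> * x2) (\<nu> * y2) = \<nu> / \<mu> * slope x1 y1 x2 y2"
    proof -
      have "\<mu> ^ 2 / \<nu> = \<nu> / \<mu>" using assms(1-3) by (simp add: field_simps power2_eq_square power3_eq_cube)
      then have tangent: "3 * (\<mu> * x1) ^ 2 / (2 * (\<nu> * y1)) = \<nu> / \<mu> * (3 * x1 ^ 2 / (2 * y1))"
        by (metis (no_types, opaque_lifting) mult.left_commute power_mult_distrib times_divide_times_eq)
      have chord: "(\<nu> * y2 - \<nu> * y1) / (\<mu> * x2 - \<mu> * x1) = \<nu> / \<mu> * ((y2 - y1) / (x2 - x1))"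
        by (simp flip: right_diff_distrib)
      show ?thesis
      proof (cases "x1 = x2")
        case True
        then show ?thesis using tangent unfolding slope_def by (simp only: if_True refl)
      next
        case False
        then show ?thesis using chord assms(1) by (simp add: slope_def)
      qed
    qed
    have \<mu>: "\<nu> ^ 2 / \<mu> ^ 2 = \<mu>" using assms(1-3) by (simp add: power2_eq_square power3_eq_cube)
    have add: "curve_add (aff_pt x1 y1) (aff_pt x2 y2) = (if x1 = x2 \<and> y1 = - y2 then inf_pt
        else let l = slope x1 y1 x2 y2; x3 = l ^ 2 - x1 - x2 in aff_pt x3 (l * (x1 - x3) - y1))"
      for x1 y1 x2 y2 by (simp add: curve_add_def slope_def Let_def)
    have opposite: "\<mu> * x1 = \<mu> * x2 \<and> \<nu> * y1 = - (\<nu> * y2) \<longleftrightarrow> x1 = x2 \<and> y1 = - y2"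
      using assms(1,2) by (metis minus_mult_right mult_left_cancel)
    define l where "l = slope x1 y1 x2 y2"
    define x3 where "x3 = l ^ 2 - x1 - x2"
    have "(\<nu> / \<mu> * l) ^ 2 = \<nu> ^ 2 / \<mu> ^ 2 * l ^ 2" by (simp add: power_mult_distrib power_divide)
    then have x3: "(\<nu> / \<mu> * l) ^ 2 - \<mu> * x1 - \<mu> * x2 = \<mu> * x3"
      unfolding \<mu> by (simp add: x3_def algebra_simps)
    have y3: "\<nu> / \<mu> * l * (\<mu> * x1 - \<mu> * x3) - \<nu> * y1 = \<nu> * (l * (x1 - x3) - y1)"
      using assms(1) by (simp add: field_simps)
    have "curve_add (aff_pt (\<mu> * x1) (\<nu> * y1)) (aff_pt (\<mu> * x2) (\<nu> * y2)) =
        (if x1 = x2 \<and> y1 = - y2 then inf_pt else aff_pt (\<mu> * x3) (\<nu> * (l * (x1 - x3) - y1)))"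
      unfolding add slope opposite Let_def l_def[symmetric] x3 y3 ..
    moreover have "curve_add (aff_pt x1 y1) (aff_pt x2 y2) =
        (if x1 = x2 \<and> y1 = - y2 then inf_pt else aff_pt x3 (l * (x1 - x3) - y1))"
      unfolding add Let_def l_def[symmetric] x3_def ..
    ultimately show ?thesis
      using assms(1,2) unfolding u v by simp
  qed (use assms u in \<open>simp add: curve_add_def\<close>)
qed (use assms in \<open>simp add: curve_add_def\<close>)

section \<open>The curve as an algebraic group\<close>

lemma proj_closed_empty: "proj_closed {}"
  unfolding proj_closed_def by (rule exI[of _ "{\<lambda>v. 1}"]) (auto intro: hom_poly.const)

lemma hom_poly_curve_equation:
  "hom_poly 3 (\<lambda>v :: complex ^ 3. v$2 ^ 2 * v$3 + ((- 1) * v$1 ^ 3 + (- c) * v$3 ^ 3))"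
proof (intro hom_poly.add hom_poly_cmult)
  have "hom_poly (n * 1) (\<lambda>v :: complex ^ 3. v$i ^ n)" for i n
    by (intro hom_poly_power hom_poly.coord)
  from this[of 2 2] this[of 3] hom_poly.coord[of "3 :: 3"]
  show "hom_poly 3 (\<lambda>v :: complex ^ 3. v$1 ^ 3)" "hom_poly 3 (\<lambda>v :: complex ^ 3. v$3 ^ 3)"
    "hom_poly 3 (\<lambda>v :: complex ^ 3. v$2 ^ 2 * v$3)"
    using hom_poly.mult by fastforce+
qed

lemma proj_closed_curve: "proj_closed (curve c)"
proof -
  define E where "E = (\<lambda>v :: complex ^ 3. v$2 ^ 2 * v$3 + ((- 1) * v$1 ^ 3 + (- c) * v$3 ^ 3))"
  have E: "abs_proj v \<in> curve c \<longleftrightarrow> E v = 0" if "v \<noteq> 0" for v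
    using that by (simp add: abs_proj_in_curve_iff E_def algebra_simps add_eq_0_iff2)
  have "curve c = {abs_proj v | v. v \<noteq> 0 \<and> (\<forall>F\<in>{E}. F v = 0)}"
  proof (intro equalityI subsetI)
    fix p assume "p \<in> curve c"
    moreover obtain v where "v \<noteq> 0" "p = abs_proj v" by (rule proj_exhaust)
    ultimately show "p \<in> {abs_proj v | v. v \<noteq> 0 \<and> (\<forall>F\<in>{E}. F v = 0)}"
      using E by blast
  next
    fix p assume "p \<in> {abs_proj v | v. v \<noteq> 0 \<and> (\<forall>F\<in>{E}. F v = 0)}"
    then obtain v where "p = abs_proj v" "v \<noteq> 0" "E v = 0" by blast
    then show "p \<in> curve c" using E by blast
  qed
  moreover have "\<forall>F\<in>{E}. \<exists>d. hom_poly d F"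
    using hom_poly_curve_equation[of c] unfolding E_def by blast
  ultimately have "(\<forall>F\<in>{E}. \<exists>d. hom_poly d F) \<and>
      curve c = {abs_proj v | v. v \<noteq> 0 \<and> (\<forall>F\<in>{E}. F v = 0)}" by (rule conjI[rotated])
  then show ?thesis unfolding proj_closed_def by (rule exI)
qed

lemma quasi_projective_curve: "quasi_projective (curve c)"
proof -
  have "curve c = curve c - {}" by simp
  then show ?thesis
    unfolding quasi_projective_def
    by (intro exI[of _ "curve c"] exI[of _ "{}"] conjI proj_closed_curve proj_closed_empty)
qed

lemma regular_map2_formulas:
  assumes "\<And>v0 w0. v0 \<noteq> 0 \<Longrightarrow> w0 \<noteq> 0 \<Longrightarrow> abs_proj v0 \<in> S \<Longrightarrow> abs_proj w0 \<in> T \<Longrightarrow>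
    \<exists>d e F. (\<forall>i. bihom_poly d e (\<lambda>v w. F v w $ i)) \<and> F v0 w0 \<noteq> 0 \<and>
      (\<forall>v w. v \<noteq> 0 \<and> w \<noteq> 0 \<and> abs_proj v \<in> S \<and> abs_proj w \<in> T \<and> F v w \<noteq> 0 \<longrightarrow>
        f (abs_proj v) (abs_proj w) = abs_proj (F v w))"
  shows "regular_map2 S T f"
  unfolding regular_map2_def
proof (intro allI impI)
  fix v0 w0
  assume "v0 \<noteq> 0 \<and> w0 \<noteq> 0 \<and> abs_proj v0 \<in> S \<and> abs_proj w0 \<in> T"
  then have "v0 \<noteq> 0" "w0 \<noteq> 0" "abs_proj v0 \<in> S" "abs_proj w0 \<in> T" by simp_all
  from assms[OF this] obtain d e F where "\<forall>i. bihom_poly d e (\<lambda>v w. F v w $ i)" "F v0 w0 \<noteq> 0"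
      "\<forall>v w. v \<noteq> 0 \<and> w \<noteq> 0 \<and> abs_proj v \<in> S \<and> abs_proj w \<in> T \<and> F v w \<noteq> 0 \<longrightarrow>
        f (abs_proj v) (abs_proj w) = abs_proj (F v w)"
    by (elim exE conjE)
  then show "\<exists>d e F. (\<forall>i. bihom_poly d e (F i)) \<and> (\<chi> i. F i v0 w0) \<noteq> 0 \<and>
        (\<forall>v w. v \<noteq> 0 \<and> w \<noteq> 0 \<and> abs_proj v \<in> S \<and> abs_proj w \<in> T \<and> (\<chi> i. F i v w) \<noteq> 0 \<longrightarrow>
          f (abs_proj v) (abs_proj w) = abs_proj (\<chi> i. F i v w))"
    by (intro exI[of _ d] exI[of _ e] exI[of _ "\<lambda>i v w. F v w $ i"]) (simp add: vec_lambda_eta)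
qed

lemma bihom_poly_fermat_law:
  fixes A :: "complex ^ 'm \<Rightarrow> complex ^ 3" and B :: "complex ^ 'n \<Rightarrow> complex ^ 3"
  assumes "\<And>i. bihom_poly 1 0 (\<lambda>v (w :: complex ^ 'n). A v $ i)"
    and "\<And>i. bihom_poly 0 1 (\<lambda>(v :: complex ^ 'm) w. B w $ i)"
  shows "bihom_poly 2 2 (\<lambda>v w. fermat_law (A v) (B w) $ i)"
proof -
  have A: "bihom_poly 2 0 (\<lambda>v (w :: complex ^ 'n). A v $ i ^ 2)"
      "bihom_poly 2 0 (\<lambda>v (w :: complex ^ 'n). A v $ i * A v $ j)" for i j
    using bihom_poly_power[OF assms(1), of 2 i] bihom_poly.mult[OF assms(1) assms(1), of i j]
    by (simp_all add: numeral_2_eq_2)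
  have B: "bihom_poly 0 2 (\<lambda>(v :: complex ^ 'm) w. B w $ i ^ 2)"
      "bihom_poly 0 2 (\<lambda>(v :: complex ^ 'm) w. B w $ i * B w $ j)" for i j
    using bihom_poly_power[OF assms(2), of 2 i] bihom_poly.mult[OF assms(2) assms(2), of i j]
    by (simp_all add: numeral_2_eq_2)
  have "bihom_poly 2 2 (\<lambda>v w. A v $ i ^ 2 * (B w $ j * B w $ k))"
    "bihom_poly 2 2 (\<lambda>v w. B w $ i ^ 2 * (A v $ j * A v $ k))" for i j k
    using bihom_poly.mult[OF A(1) B(2)] bihom_poly.mult[OF B(1) A(2)] by (simp_all add: numeral_2_eq_2)
  note bihom_poly_diff[OF this]
  then have "\<forall>i. bihom_poly 2 2 (\<lambda>v w. fermat_law (A v) (B w) $ i)"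
    unfolding forall_3 fermat_law_nth by (simp add: mult.assoc)
  then show ?thesis by blast
qed

context fermat_model
begin

lemma to_fermat_linear:
  "bihom_poly 1 0 (\<lambda>v (w :: complex ^ 'b). to_fermat v $ i)"
  "bihom_poly 0 1 (\<lambda>(v :: complex ^ 'a) w. to_fermat w $ i)"
proof -
  have *: "bihom_poly 1 0 (\<lambda>v (w :: complex ^ 'b). k * v $ (1 :: 3))"
    "bihom_poly 1 0 (\<lambda>v (w :: complex ^ 'b). r * v $ (3 :: 3) + v $ 2)"
    "bihom_poly 1 0 (\<lambda>v (w :: complex ^ 'b). r * v $ (3 :: 3) - v $ 2)"
    "bihom_poly 0 1 (\<lambda>(v :: complex ^ 'a) w. k * w $ (1 :: 3))"
    "bihom_poly 0 1 (\<lambda>(v :: complex ^ 'a) w. r * w $ (3 :: 3) + w $ 2)"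
    "bihom_poly 0 1 (\<lambda>(v :: complex ^ 'a) w. r * w $ (3 :: 3) - w $ 2)"
    by (intro bihom_poly_cmult bihom_poly_diff bihom_poly.add bihom_poly.coord1 bihom_poly.coord2)+
  have "\<forall>i. bihom_poly 1 0 (\<lambda>v (w :: complex ^ 'b). to_fermat v $ i)"
    "\<forall>i. bihom_poly 0 1 (\<lambda>(v :: complex ^ 'a) w. to_fermat w $ i)"
    unfolding forall_3 to_fermat_nth by (intro conjI *)+
  then show "bihom_poly 1 0 (\<lambda>v (w :: complex ^ 'b). to_fermat v $ i)"
    "bihom_poly 0 1 (\<lambda>(v :: complex ^ 'a) w. to_fermat w $ i)" by blast+
qed

lemma of_fermat_linear:
  assumes "\<And>i. bihom_poly d e (\<lambda>v w. F v w $ i)"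
  shows "bihom_poly d e (\<lambda>v w. of_fermat (F v w) $ i)"
proof -
  have "\<forall>i. bihom_poly d e (\<lambda>v w. of_fermat (F v w) $ i)"
    unfolding forall_3 of_fermat_nth
    by (intro conjI bihom_poly_divide bihom_poly_diff bihom_poly.add assms)
  then show ?thesis by blast
qed

text \<open>The law and one of its translates, read in the coordinates of the curve, are given by forms of
bidegree \<open>(2, 2)\<close>, and at every pair of points one of them does not vanish.\<close>

lemma regular_map2_curve_add: "regular_map2 (curve c) (curve c) curve_add"
proof (rule regular_map2_formulas)
  fix v0 w0 assume vw0: "v0 \<noteq> 0" "w0 \<noteq> 0" "abs_proj v0 \<in> curve c" "abs_proj w0 \<in> curve c"
  define F where "F = (\<lambda>v w. of_fermat (fermat_law (to_fermat v) (to_fermat w)))"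
  define F' where "F' = (\<lambda>v w. of_fermat (rot (rot (fermat_law (rot (to_fermat v)) (to_fermat w)))))"
  have rot_bihom: "bihom_poly d e (\<lambda>v w. rot (G v w) $ i)"
    if "\<And>i. bihom_poly d e (\<lambda>v w. G v w $ i)" for d e i and G :: "complex ^ 3 \<Rightarrow> complex ^ 3 \<Rightarrow> complex ^ 3"
  proof -
    have "\<forall>i. bihom_poly d e (\<lambda>v w. rot (G v w) $ i)"
      unfolding forall_3 rot_nth by (intro conjI that)
    then show ?thesis by blast
  qed
  have F_bihom: "\<forall>i. bihom_poly 2 2 (\<lambda>v w. F v w $ i)"
    unfolding F_def by (intro allI of_fermat_linear bihom_poly_fermat_law to_fermat_linear)
  have F'_bihom: "\<forall>i. bihom_poly 2 2 (\<lambda>v w. F' v w $ i)"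
    unfolding F'_def
    by (intro allI of_fermat_linear rot_bihom bihom_poly_fermat_law to_fermat_linear)
  have F: "curve_add (abs_proj v) (abs_proj w) = abs_proj (F v w)"
    if "v \<noteq> 0 \<and> w \<noteq> 0 \<and> abs_proj v \<in> curve c \<and> abs_proj w \<in> curve c \<and> F v w \<noteq> 0" for v w
    using that fermat_sum_law[of "to_fermat v" "to_fermat w"]
    by (subst curve_add_eq_iff) (simp_all add: F_def curve_sum_def fermat_point_to_fermat)
  have F': "curve_add (abs_proj v) (abs_proj w) = abs_proj (F' v w)"
    if "v \<noteq> 0 \<and> w \<noteq> 0 \<and> abs_proj v \<in> curve c \<and> abs_proj w \<in> curve c \<and> F' v w \<noteq> 0" for v w
  proof -
    let ?s = "fermat_law (rot (to_fermat v)) (to_fermat w)"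
    have "fermat_sum (rot (to_fermat v)) (to_fermat w) (rot (rot (rot ?s)))"
      using that fermat_sum_law[of "rot (to_fermat v)" "to_fermat w"]
      by (simp add: F'_def fermat_point_to_fermat)
    then have "curve_sum v w (F' v w)"
      unfolding fermat_sum_rot by (simp add: F'_def curve_sum_def)
    then show ?thesis using that by (subst curve_add_eq_iff) auto
  qed
  have "F v0 w0 \<noteq> 0 \<or> F' v0 w0 \<noteq> 0"
    using fermat_law_two_of_three(1)[of "to_fermat v0" "to_fermat w0"] vw0
    by (simp add: F_def F'_def fermat_point_to_fermat)
  then show "\<exists>d e F. (\<forall>i. bihom_poly d e (\<lambda>v w. F v w $ i)) \<and> F v0 w0 \<noteq> 0 \<and>
      (\<forall>v w. v \<noteq> 0 \<and> w \<noteq> 0 \<and> abs_proj v \<in> curve c \<and> abs_proj w \<in> curve c \<and> F v w \<noteq> 0 \<longrightarrow>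
        curve_add (abs_proj v) (abs_proj w) = abs_proj (F v w))"
  proof
    assume "F v0 w0 \<noteq> 0"
    then show ?thesis
      by (intro exI[of _ 2] exI[of _ F] conjI) (rule F_bihom, assumption, intro allI impI, rule F)
  next
    assume "F' v0 w0 \<noteq> 0"
    then show ?thesis
      by (intro exI[of _ 2] exI[of _ F'] conjI) (rule F'_bihom, assumption, intro allI impI, rule F')
  qed
qed

end

lemma exists_fermat_model: 
  assumes "c \<noteq> 0"
  shows "\<exists>r k. fermat_model c r k"
proof -
  obtain r where r: "- 3 * c = r ^ 2"
    by (rule exists_complex_root[of 2]) simp
  obtain k where k: "- 6 * r = k ^ 3"
    by (rule exists_complex_root[of 3]) simp
  have "fermat_model c r k"
    by (rule fermat_model.intro) (simp_all only: assms not_False_eq_True r k)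
  then show ?thesis by blast
qed

lemma curve_group_simps [simp]:
  "carrier (curve_group c) = curve c" "monoid.mult (curve_group c) = curve_add"
  "one (curve_group c) = inf_pt"
  by (simp_all add: curve_group_def)

lemma curve_add_opposite:
  assumes "u \<in> curve c"
  shows "curve_add (curve_scale 1 (- 1) u) u = inf_pt"
  using assms by (cases rule: curve_cases) (simp_all add: curve_add_def)

lemma group_curve_group:
  assumes "c \<noteq> 0"
  shows "group (curve_group c)"
proof -
  obtain r k where "fermat_model c r k" using exists_fermat_model assms by blast
  then interpret fermat_model c r k .
  show ?thesis
  proof (rule groupI)
    fix u assume "u \<in> carrier (curve_group c)"
    then have "curve_scale 1 (- 1) u \<in> curve c" "curve_add (curve_scale 1 (- 1) u) u = inf_pt"
      using curve_add_opposite[of u c] curve_scale_in_curve[of 1 "-1" u c] by simp_all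
    then show "\<exists>v\<in>carrier (curve_group c). v \<otimes>\<^bsub>curve_group c\<^esub> u = \<one>\<^bsub>curve_group c\<^esub>"
      unfolding curve_group_simps by blast
    show "\<one>\<^bsub>curve_group c\<^esub> \<otimes>\<^bsub>curve_group c\<^esub> u = u"
      unfolding curve_group_simps by (simp add: curve_add_def)
  qed (simp_all add: curve_add_closed curve_add_assoc)
qed

lemma inv_curve_group:
  assumes "c \<noteq> 0" "u \<in> curve c"
  shows "inv\<^bsub>curve_group c\<^esub> u = curve_scale 1 (- 1) u"
  using group.inv_equality[OF group_curve_group[OF assms(1)], of "curve_scale 1 (- 1) u" u] assms
    curve_add_opposite[of u c] curve_scale_in_curve[of 1 "-1" u c] by simp

lemma algebraic_group_curve_group:
  assumes "c \<noteq> 0"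
  shows "algebraic_group (curve_group c)"
proof -
  obtain r k where "fermat_model c r k" using exists_fermat_model assms by blast
  then interpret fermat_model c r k .
  have "regular_map (curve c) (\<lambda>u. inv\<^bsub>curve_group c\<^esub> u)"
    by (rule regular_map_cong[OF regular_map_diag_act[of "vector [1, - 1, 1]"]])
      (simp_all add: forall_3 inv_curve_group assms curve_scale_def)
  then show ?thesis
    unfolding algebraic_group_def
    using group_curve_group assms quasi_projective_curve regular_map2_curve_add by simp
qed

lemma curve_scale_image:
  assumes "\<mu> \<noteq> 0" "\<nu> \<noteq> 0" "\<nu> ^ 2 = \<mu> ^ 3"
  shows "curve_scale \<mu> \<nu> ` curve c = curve (\<nu> ^ 2 * c)"
proof (intro equalityI subsetI)
  fix u assume u: "u \<in> curve (\<nu> ^ 2 * c)"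
  define v where "v = curve_scale (1 / \<mu>) (1 / \<nu>) u"
  have "v \<in> curve ((1 / \<nu>) ^ 2 * (\<nu> ^ 2 * c))"
    unfolding v_def using assms u by (intro curve_scale_in_curve) (simp_all add: power_divide)
  then have "v \<in> curve c" using assms by (simp add: power_divide)
  moreover have "curve_scale \<mu> \<nu> v = u"
    unfolding v_def using assms u by (simp add: curve_scale_curve_scale curve_scale_1)
  ultimately show "u \<in> curve_scale \<mu> \<nu> ` curve c" by blast
qed (use assms curve_scale_in_curve in blast)

lemma algebraic_group_iso_curve_scale:
  assumes "\<mu> \<noteq> 0" "\<nu> \<noteq> 0" "\<nu> ^ 2 = \<mu> ^ 3" "c \<noteq> 0" "c' = \<nu> ^ 2 * c"
    and f: "\<And>u. u \<in> curve c \<Longrightarrow> f u = curve_scale \<mu> \<nu> u"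
  shows "algebraic_group_iso (curve_group c) (curve_group c') f"
proof -
  obtain r k where "fermat_model c r k" using exists_fermat_model assms by blast
  then interpret fermat_model c r k .
  have bireg: "biregular (curve c) (curve c') f"
    using assms curve_scale_image[OF assms(1-3)]
    by (intro biregular_diag_act[of "vector [\<mu>, \<nu>, 1]"]) (simp_all add: forall_3 curve_scale_def)
  moreover have "curve_scale \<mu> \<nu> u \<in> curve c'" if "u \<in> curve c" for u
    using curve_scale_in_curve[OF assms(1-3) that] assms(5) by simp
  then have "f \<in> hom (curve_group c) (curve_group c')"
    using assms(1-3) f by (auto simp: hom_def curve_add_closed curve_scale_add)
  with bireg show ?thesis
    by (simp add: algebraic_group_iso_def iso_def biregular_def)
qed

section \<open>The rotations of order three\<close>

abbreviation omega :: complex where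
  "omega \<equiv> exp (2 * of_real pi * \<i> / 3)"

lemma omega_cube: "omega ^ 3 = 1"
  by (simp add: exp_of_nat_mult[symmetric] exp_eq_1)

lemma omega_neq_1: "omega \<noteq> 1"
proof
  assume "omega = 1"
  then obtain n :: int where "2 * pi / 3 = of_int (2 * n) * pi"
    by (auto simp: exp_eq_1)
  then have "of_int (3 * n) = (1 :: real)" by simp
  then have "3 * n = 1" by (metis of_int_eq_1_iff)
  then show False by presburger
qed

lemma omega_sum: "1 + omega + omega ^ 2 = 0"
proof -
  have "(omega - 1) * (1 + omega + omega ^ 2) = 0" using omega_cube by algebra
  then show ?thesis using omega_neq_1 by simp
qed

lemma cube_eq_cube_iff:
  "x ^ 3 = y ^ 3 \<longleftrightarrow> (\<exists>j\<in>{0, 1, 2}. y = omega ^ j * x)"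
proof
  assume "x ^ 3 = y ^ 3"
  then have "(y - x) * ((y - omega * x) * (y - omega ^ 2 * x)) = 0"
    using omega_sum omega_cube by algebra
  then show "\<exists>j\<in>{0, 1, 2}. y = omega ^ j * x" by auto
next
  assume "\<exists>j\<in>{0, 1, 2}. y = omega ^ j * x"
  then have "\<exists>j. y = omega ^ j * x" by blast
  then obtain j where y: "y = omega ^ j * x" by blast
  have "y ^ 3 = (omega ^ 3) ^ j * x ^ 3" 
    unfolding y by (simp only: power_mult_distrib power_mult[symmetric] mult.commute)
  then show "x ^ 3 = y ^ 3" by (simp add: omega_cube)
qed

text \<open>The \<open>j\<close>-th power of \<open>phi3\<close> in the automorphism group.\<close>

definition rotation :: "complex \<Rightarrow> nat \<Rightarrow> CP2 \<Rightarrow> CP2" where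
  "rotation c j = restrict (curve_scale (omega ^ j) 1) (curve c)"

lemma rotation_apply: "u \<in> curve c \<Longrightarrow> rotation c j u = curve_scale (omega ^ j) 1 u"
  by (simp add: rotation_def)

lemma omega_power_cube: "(omega ^ j) ^ 3 = 1"
  by (metis omega_cube mult.commute power_mult power_one)

lemma rotation_in_curve: "u \<in> curve c \<Longrightarrow> rotation c j u \<in> curve c"
  using curve_scale_in_curve[of "omega ^ j" 1 u c] by (simp add: rotation_apply omega_power_cube)

lemma rotation_iso: "c \<noteq> 0 \<Longrightarrow> algebraic_group_iso (curve_group c) (curve_group c) (rotation c j)"
  by (rule algebraic_group_iso_curve_scale[of "omega ^ j" 1])
    (simp_all add: omega_power_cube rotation_apply)

lemma rotation_auto: "c \<noteq> 0 \<Longrightarrow> rotation c j \<in> auto (curve_group c)"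
  using rotation_iso[of c j]
  by (simp add: auto_def algebraic_group_iso_def iso_def Bij_def rotation_def)

lemma rotation_0: "rotation c 0 = \<one>\<^bsub>AutoGroup (curve_group c)\<^esub>"
  by (simp add: AutoGroup_def BijGroup_def rotation_def fun_eq_iff curve_scale_1 restrict_def)

lemma rotation_mult:
  assumes "c \<noteq> 0"
  shows "rotation c i \<otimes>\<^bsub>AutoGroup (curve_group c)\<^esub> rotation c j = rotation c (i + j)"
proof -
  have "rotation c i \<in> Bij (curve c)" for i
    using rotation_auto[OF assms, of i] by (simp add: auto_def)
  then have "rotation c i \<otimes>\<^bsub>AutoGroup (curve_group c)\<^esub> rotation c j =
      compose (curve c) (rotation c i) (rotation c j)"
    by (simp add: AutoGroup_def BijGroup_def)
  also have "\<dots> = rotation c (i + j)"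
  proof
    fix u show "compose (curve c) (rotation c i) (rotation c j) u = rotation c (i + j) u"
    proof (cases "u \<in> curve c")
      case True
      then show ?thesis
        using rotation_in_curve[OF True, of j]
        by (simp add: compose_def rotation_apply curve_scale_curve_scale[OF _ _ _ _ True] power_add)
    qed (simp add: compose_def rotation_def)
  qed
  finally show ?thesis .
qed

lemma rotation_mod_3: "rotation c j = rotation c (j mod 3)"
proof -
  have "omega ^ j = (omega ^ 3) ^ (j div 3) * omega ^ (j mod 3)"
    by (simp only: power_mult[symmetric] power_add[symmetric]) simp
  then have "omega ^ j = omega ^ (j mod 3)" by (simp only: omega_cube power_one mult_1)
  then show ?thesis unfolding rotation_def by simp
qed

lemma phi3_eq_rotation: "phi3 c = rotation c 1"
  unfolding phi3_def rotation_def
proof (rule restrict_ext)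
  fix u assume "u \<in> curve c"
  then show "(if u = inf_pt then inf_pt else aff_pt (omega * zeta_coord u) (eta_coord u)) =
      curve_scale (omega ^ 1) 1 u"
    by (cases rule: curve_cases) simp_all
qed

text \<open>The powers of \<open>phi3\<close> depend on the exponent modulo 3 only and are closed under products and
inverses, so they are the generated subgroup.\<close>

lemma phi3_group_eq:
  assumes "c \<noteq> 0"
  shows "phi3_group c = {rotation c 0, rotation c 1, rotation c 2}"
    and "subgroup (phi3_group c) (AutoGroup (curve_group c))"
proof -
  interpret A: group "AutoGroup (curve_group c)"
    using group.AutoGroup[OF group_curve_group[OF assms]] .
  have carrier: "rotation c j \<in> carrier (AutoGroup (curve_group c))" for j
    using rotation_auto[OF assms] by (simp add: AutoGroup_def)
  show sub: "subgroup (phi3_group c) (AutoGroup (curve_group c))"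
    unfolding phi3_group_def phi3_eq_rotation using carrier by (intro A.generate_is_subgroup) auto
  let ?H = "range (rotation c)"
  have H: "subgroup ?H (AutoGroup (curve_group c))"
  proof (rule A.subgroupI)
    fix h assume "h \<in> ?H"
    then obtain j where j: "h = rotation c j" by blast
    have "rotation c (2 * j) \<otimes>\<^bsub>AutoGroup (curve_group c)\<^esub> rotation c j = \<one>\<^bsub>AutoGroup (curve_group c)\<^esub>"
      using rotation_mod_3[of c "2 * j + j"] by (simp add: rotation_mult assms flip: rotation_0)
    then have "inv\<^bsub>AutoGroup (curve_group c)\<^esub> h = rotation c (2 * j)"
      using carrier j by (intro A.inv_equality) auto
    then show "inv\<^bsub>AutoGroup (curve_group c)\<^esub> h \<in> ?H" by simp
  qed (use carrier rotation_mult[OF assms] in auto)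
  have "phi3_group c = ?H"
  proof
    show "phi3_group c \<subseteq> ?H"
      unfolding phi3_group_def phi3_eq_rotation by (intro A.generate_subgroup_incl H) simp
    have "rotation c j \<in> phi3_group c" for j
    proof (induction j)
      case 0
      show ?case unfolding rotation_0 using sub by (rule subgroup.one_closed)
    next
      case (Suc j)
      have "rotation c 1 \<in> phi3_group c"
        unfolding phi3_group_def phi3_eq_rotation by (simp add: generate.incl)
      from subgroup.m_closed[OF sub Suc this] show ?case
        unfolding rotation_mult[OF assms] by simp
    qed
    then show "?H \<subseteq> phi3_group c" by blast
  qed
  also have "?H = {rotation c 0, rotation c 1, rotation c 2}"
  proof -
    have "rotation c j \<in> {rotation c 0, rotation c 1, rotation c 2}" for j
    proof -
      have "j mod 3 = 0 \<or> j mod 3 = 1 \<or> j mod 3 = 2" by presburger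
      then show ?thesis using rotation_mod_3[of c j] by auto
    qed
    then show ?thesis by blast
  qed
  finally show "phi3_group c = {rotation c 0, rotation c 1, rotation c 2}" .
qed

text \<open>The three powers differ at a point with \<open>\<zeta> = 1\<close>.\<close>

lemma rotation_distinct:
  assumes "i < 3" "j < 3" "rotation c i = rotation c j"
  shows "i = j"
proof -
  obtain y where y: "1 + c = y ^ 2" by (rule exists_complex_root[of 2]) simp
  then have "aff_pt 1 y \<in> curve c" by simp
  then have "aff_pt (omega ^ i) y = aff_pt (omega ^ j) y"
    using assms(3) rotation_apply[of "aff_pt 1 y" c i] rotation_apply[of "aff_pt 1 y" c j] by simp
  then have eq: "omega ^ i = omega ^ j" by simp
  have "omega ^ 2 \<noteq> omega" "omega ^ 2 \<noteq> 1"
    using omega_neq_1 omega_cube by (auto simp: power2_eq_square power3_eq_cube)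
  moreover have "i \<in> {0, 1, 2}" "j \<in> {0, 1, 2}" using assms by auto
  ultimately show ?thesis using eq omega_neq_1 by auto
qed

lemma phi3_group_image: "c \<noteq> 0 \<Longrightarrow> phi3_group c = rotation c ` {..<3}"
  by (auto simp: phi3_group_eq lessThan_nat_numeral lessThan_Suc)

lemma inj_on_rotation: "inj_on (rotation c) {..<3}"
  using rotation_distinct by (auto simp: inj_on_def)

lemma card_phi3_group: "c \<noteq> 0 \<Longrightarrow> card (phi3_group c) = 3"
  by (simp add: phi3_group_image card_image inj_on_rotation)

lemma mset_phi3_group:
  assumes "c \<noteq> 0"
  shows "{# f h. h \<in># mset_set (phi3_group c) #} =
    {# f (rotation c 0), f (rotation c 1), f (rotation c 2) #}"
proof -
  have "mset_set (phi3_group c) = image_mset (rotation c) (mset_set {..<3})"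
    unfolding phi3_group_image[OF assms] by (rule image_mset_mset_set[OF inj_on_rotation, symmetric])
  also have "mset_set {..<3::nat} = {#0, 1, 2#}"
    by (simp add: lessThan_nat_numeral lessThan_Suc)
  finally show ?thesis by (simp add: image_mset.compositionality)
qed

section \<open>The orbit space and the three-valued product\<close>

lemma curve_proj_inf: "curve_proj inf_pt = CP1_pt 0 1"
  by (simp add: curve_proj_def of_complex_def)

lemma curve_proj_aff: "curve_proj (aff_pt x y) = CP1_pt 1 y"
  by (simp add: curve_proj_def)

lemma curve_proj_abs_proj:
  assumes "v \<noteq> 0" "abs_proj v \<in> curve c"
  shows "curve_proj (abs_proj v) = CP1_pt (v$3) (v$2)" and "(v$3, v$2) \<noteq> (0, 0)"
proof -
  show nz: "(v$3, v$2) \<noteq> (0, 0)"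
    using assms by (auto simp: abs_proj_in_curve_iff vec3_eq_iff)
  show "curve_proj (abs_proj v) = CP1_pt (v$3) (v$2)"
  proof (cases "v$3 = 0")
    case False
    then show ?thesis
      by (simp add: abs_proj_affine curve_proj_aff CP1_pt_eq_iff)
  next
    case True
    then have "v$1 = 0" using assms by (simp add: abs_proj_in_curve_iff)
    then have "abs_proj v = inf_pt"
      using True assms(1)
      by (auto simp: inf_pt_def abs_proj_eq_iff vec3_eq_iff intro!: exI[of _ "1 / v$2"])
    then show ?thesis using nz True by (simp add: curve_proj_inf CP1_pt_eq_iff)
  qed
qed

text \<open>A representative in the plane can be scaled to have prescribed homogeneous coordinates of its image
on the line.  This reduces statements about arbitrary coordinates on the line to vectors on the
curve.\<close>

lemma curve_representative:
  assumes "p \<in> curve c" "curve_proj p = CP1_pt a b" "(a, b) \<noteq> (0, 0)"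
  obtains v where "v \<noteq> 0" "p = abs_proj v" "v$3 = a" "v$2 = b"
proof -
  obtain u where u: "u \<noteq> 0" "p = abs_proj u" by (rule proj_exhaust)
  have nz: "(u$3, u$2) \<noteq> (0, 0)" and eq: "CP1_pt (u$3) (u$2) = CP1_pt a b"
    using curve_proj_abs_proj[of u c] assms u by auto
  then have cross: "u$3 * b = a * u$2" using CP1_pt_eq_iff assms(3) by blast
  obtain l where l: "l \<noteq> 0" "l * u$3 = a" "l * u$2 = b"
  proof (cases "u$3 = 0")
    case True
    then have "u$2 \<noteq> 0" "a = 0" "b \<noteq> 0" using nz cross assms(3) by auto
    then show thesis using that[of "b / u$2"] True by simp
  next
    case False
    then have "a \<noteq> 0" using cross assms(3) by auto
    then show thesis using that[of "a / u$3"] False cross by (simp add: field_simps)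
  qed
  have "l *s u \<noteq> 0" using l(1) u(1) by simp
  moreover have "p = abs_proj (l *s u)" using u l(1) by (simp add: abs_proj_smult)
  ultimately show thesis using that[of "l *s u"] l by simp
qed

lemma curve_proj_surj: "curve_proj ` curve c = UNIV"
proof (intro equalityI subsetI)
  fix p :: CP1
  obtain a b where ab: "(a, b) \<noteq> (0, 0)" "p = CP1_pt a b" by (rule CP1_exhaust)
  \<comment> \<open>The equation of the curve is solved for the first coordinate.\<close>
  obtain x where x: "b ^ 2 * a - c * a ^ 3 = x ^ 3"
    by (rule exists_complex_root[of 3]) simp
  define v :: "complex ^ 3" where "v = vector [x, b, a]"
  have v: "v \<noteq> 0" using ab by (auto simp: v_def)
  then have on: "abs_proj v \<in> curve c"
    using x by (simp add: abs_proj_in_curve_iff v_def algebra_simps)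
  have "p = curve_proj (abs_proj v)"
    unfolding curve_proj_abs_proj(1)[OF v on] ab(2) by (simp add: v_def)
  then show "p \<in> curve_proj ` curve c" using on by blast
qed simp

text \<open>Two affine points with the same \<open>\<eta>\<close> have the same \<open>\<zeta> ^ 3\<close>.\<close>

lemma curve_proj_eq_iff:
  assumes "c \<noteq> 0" "u \<in> curve c" "v \<in> curve c"
  shows "curve_proj u = curve_proj v \<longleftrightarrow> (\<exists>h\<in>phi3_group c. v = h u)"
proof -
  have "(\<exists>h\<in>phi3_group c. v = h u) \<longleftrightarrow> (\<exists>j\<in>{0, 1, 2}. v = curve_scale (omega ^ j) 1 u)"
    using assms by (simp add: phi3_group_eq rotation_apply)
  also have "\<dots> \<longleftrightarrow> curve_proj u = curve_proj v"
    using assms(2)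
  proof (cases rule: curve_cases)
    case 1
    from assms(3) show ?thesis
      by (cases rule: curve_cases) (auto simp: 1 curve_proj_inf curve_proj_aff CP1_pt_eq_iff)
  next
    case u: (2 x y)
    from assms(3) show ?thesis
    proof (cases rule: curve_cases)
      case v: (2 x' y')
      have "(\<exists>j\<in>{0, 1, 2}. v = curve_scale (omega ^ j) 1 u) \<longleftrightarrow>
          (\<exists>j\<in>{0, 1, 2}. x' = omega ^ j * x) \<and> y = y'"
        unfolding u(1) v(1) by (simp del: power_0) blast
      also have "\<dots> \<longleftrightarrow> x ^ 3 = x' ^ 3 \<and> y = y'" unfolding cube_eq_cube_iff ..
      also have "\<dots> \<longleftrightarrow> y = y'" using u(2) v(2) by auto
      also have "\<dots> \<longleftrightarrow> curve_proj u = curve_proj v"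
        by (auto simp: u(1) v(1) curve_proj_aff CP1_pt_eq_iff)
      finally show ?thesis .
    qed (auto simp: u curve_proj_inf curve_proj_aff CP1_pt_eq_iff)
  qed
  finally show ?thesis by blast
qed

lemma regular_map_curve_proj: "regular_map (curve c) curve_proj"
proof (rule regular_map_formula)
  show "hom_poly 1 (\<lambda>v :: complex ^ 3. v $ (if i = 1 then 3 else 2))" for i :: 2
    by (rule hom_poly.coord)
  fix v :: "complex ^ 3" assume v: "v \<noteq> 0" "abs_proj v \<in> curve c"
  have eq: "(\<chi> i :: 2. v $ (if i = 1 then 3 else 2)) = vector [v$3, v$2]"
    by (simp add: vec_eq_iff forall_2)
  show "(\<chi> i :: 2. v $ (if i = 1 then 3 else 2)) \<noteq> 0 \<and>
      curve_proj (abs_proj v) = abs_proj (\<chi> i :: 2. v $ (if i = 1 then 3 else 2))"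
    unfolding eq using curve_proj_abs_proj[OF v] by (auto simp: CP1_pt_def vec_eq_iff forall_2)
qed

lemma CP1_uminus_pt: "(a, b) \<noteq> (0, 0) \<Longrightarrow> CP1_uminus (CP1_pt a b) = CP1_pt (- a) b"
  unfolding CP1_pt_def by (subst CP1_uminus.abs_eq[OF proj_rel_refl]) (auto simp: vec_eq_iff forall_2)

lemma CP1_uminus_curve_proj:
  assumes "c \<noteq> 0" "u \<in> curve c"
  shows "CP1_uminus (curve_proj u) = curve_proj (inv\<^bsub>curve_group c\<^esub> u)"
  unfolding inv_curve_group[OF assms] using assms(2)
  by (cases rule: curve_cases)
    (simp_all add: curve_proj_inf curve_proj_aff CP1_uminus_pt CP1_pt_eq_iff)

lemma regular_map_CP1_uminus: "regular_map UNIV CP1_uminus"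
proof -
  have "CP1_uminus p = diag_act (vector [- 1, 1]) p" for p
  proof -
    obtain v where v: "v \<noteq> 0" "p = abs_proj v" by (rule proj_exhaust)
    have "(\<chi> i. (vector [- 1, 1] :: complex ^ 2) $ i * v $ i) = vector [- (v$1), v$2]"
      by (simp add: vec_eq_iff forall_2)
    then show ?thesis using v CP1_uminus.abs_eq[OF proj_rel_refl[OF v(1)]]
      by (simp add: diag_act_abs_proj forall_2)
  qed
  then show ?thesis
    by (intro regular_map_cong[OF regular_map_diag_act[of "vector [- 1, 1]"]]) (simp_all add: forall_2)
qed

lemma form_zeros_coset_product:
  assumes "c \<noteq> 0" "u \<in> curve c" "v \<in> curve c"
    and "curve_proj u = CP1_pt x1 x0" "(x1, x0) \<noteq> (0, 0)"
    and "curve_proj v = CP1_pt y1 y0" "(y1, y0) \<noteq> (0, 0)"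
  shows "{# curve_proj (curve_add u (h v)). h \<in># mset_set (phi3_group c) #} =
      form_zeros 3 (p3_form c x1 x0 y1 y0)"
    and "\<exists>i\<le>3. p3_form c x1 x0 y1 y0 i \<noteq> 0"
proof -
  obtain r k where "fermat_model c r k" using exists_fermat_model assms by blast
  then interpret fermat_model c r k .
  obtain u' where u': "u' \<noteq> 0" "u = abs_proj u'" "u'$3 = x1" "u'$2 = x0"
    using curve_representative assms(2,4,5) by blast
  obtain v' where v': "v' \<noteq> 0" "v = abs_proj v'" "v'$3 = y1" "v'$2 = y0"
    using curve_representative assms(3,6,7) by blast
  define R where "R = (\<lambda>j. vector [omega ^ j * v'$1, v'$2, v'$3] :: complex ^ 3)"
  have R: "R j \<noteq> 0" "rotation c j v = abs_proj (R j)" "abs_proj (R j) \<in> curve c" for j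
  proof -
    show "R j \<noteq> 0" using v'(1) by (auto simp: R_def vec3_eq_iff)
    show eq: "rotation c j v = abs_proj (R j)"
      using assms(3) v'(1) by (simp add: rotation_apply v'(2) curve_scale_abs_proj R_def)
    show "abs_proj (R j) \<in> curve c"
      using rotation_in_curve[OF assms(3)] eq by metis
  qed
  have "\<exists>s. s \<noteq> 0 \<and> curve_add u (rotation c j v) = abs_proj s \<and> curve_sum u' (R j) s" for j
    unfolding u'(2) R(2) using curve_add_curve_sum_exists[of u' "R j"] u' R assms(2) by auto
  then obtain s where s: "\<And>j. s j \<noteq> 0" "\<And>j. curve_add u (rotation c j v) = abs_proj (s j)"
    "\<And>j. curve_sum u' (R j) (s j)" by metis
  have "abs_proj (s j) \<in> curve c" for j
    using curve_add_closed[OF assms(2), of "rotation c j v"] rotation_in_curve[OF assms(3)]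
    unfolding s(2) by blast
  then have proj: "curve_proj (abs_proj (s j)) = CP1_pt (s j $ 3) (s j $ 2)" for j
    using curve_proj_abs_proj(1) s(1) by blast
  note zeros = form_zeros_p3_form[OF omega_cube omega_neq_1 u'(1) _ v'(1) _ s(3)[unfolded R_def]]
  show "{# curve_proj (curve_add u (h v)). h \<in># mset_set (phi3_group c) #} =
      form_zeros 3 (p3_form c x1 x0 y1 y0)"
    using zeros(1) assms(2,3) u' v' unfolding mset_phi3_group[OF assms(1)] s(2) proj by simp
  show "\<exists>i\<le>3. p3_form c x1 x0 y1 y0 i \<noteq> 0"
    using zeros(2) assms(2,3) u' v' by simp
qed

text \<open>The product is read off from chosen preimages.  It does not depend on the choice, since by
\<open>form_zeros_coset_product\<close> the result is determined by the images alone.\<close>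

definition G3_mult :: "complex \<Rightarrow> CP1 \<Rightarrow> CP1 \<Rightarrow> CP1 multiset" where
  "G3_mult c x y = (let u = inv_into (curve c) curve_proj x; v = inv_into (curve c) curve_proj y
    in {# curve_proj (curve_add u (h v)). h \<in># mset_set (phi3_group c) #})"

lemma G3_mult_form_zeros:
  assumes "c \<noteq> 0" "(x1, x0) \<noteq> (0, 0)" "(y1, y0) \<noteq> (0, 0)"
  shows "G3_mult c (CP1_pt x1 x0) (CP1_pt y1 y0) = form_zeros 3 (p3_form c x1 x0 y1 y0)"
    and "\<exists>i\<le>3. p3_form c x1 x0 y1 y0 i \<noteq> 0"
proof -
  have mem: "inv_into (curve c) curve_proj p \<in> curve c" "curve_proj (inv_into (curve c) curve_proj p) = p" for p
    using curve_proj_surj[of c] by (metis UNIV_I inv_into_into, metis UNIV_I f_inv_into_f)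
  note * = form_zeros_coset_product[OF assms(1) mem(1) mem(1) mem(2) assms(2) mem(2) assms(3)]
  show "G3_mult c (CP1_pt x1 x0) (CP1_pt y1 y0) = form_zeros 3 (p3_form c x1 x0 y1 y0)"
    unfolding G3_mult_def Let_def by (rule *(1))
  show "\<exists>i\<le>3. p3_form c x1 x0 y1 y0 i \<noteq> 0" by (rule *(2))
qed

lemma G3_mult_curve_proj:
  assumes "c \<noteq> 0" "u \<in> curve c" "v \<in> curve c"
  shows "G3_mult c (curve_proj u) (curve_proj v) =
    {# curve_proj (curve_add u (h v)). h \<in># mset_set (phi3_group c) #}"
proof -
  obtain x1 x0 where x: "(x1, x0) \<noteq> (0, 0)" "curve_proj u = CP1_pt x1 x0" by (rule CP1_exhaust)
  obtain y1 y0 where y: "(y1, y0) \<noteq> (0, 0)" "curve_proj v = CP1_pt y1 y0" by (rule CP1_exhaust)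
  show ?thesis
    using form_zeros_coset_product(1)[OF assms x(2,1) y(2,1)] G3_mult_form_zeros(1)[OF assms(1) x(1) y(1)]
    unfolding x(2) y(2) by simp
qed

lemma mult_defined_by_G3_mult:
  assumes "c \<noteq> 0"
  shows "mult_defined_by 3 (\<lambda>z x y. p3 c z (- x) (- y)) (G3_mult c)"
  unfolding mult_defined_by_def
proof (intro exI[of _ "p3_coeff c"] conjI allI impI)
  show "p3 c z (- x) (- y) = (\<Sum>i\<le>3. \<Sum>j\<le>3. \<Sum>k\<le>3. p3_coeff c i j k * z ^ i * x ^ j * y ^ k)" for z x y
    by (rule p3_coeff_polynomial)
  fix x1 x0 y1 y0 :: complex assume "(x1, x0) \<noteq> (0, 0) \<and> (y1, y0) \<noteq> (0, 0)"
  then show "let b = \<lambda>i. \<Sum>j\<le>3. \<Sum>k\<le>3. p3_coeff c i j k * x1 ^ j * x0 ^ (3 - j) * y1 ^ k * y0 ^ (3 - k)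
      in (\<exists>i\<le>3. b i \<noteq> 0) \<and> G3_mult c (CP1_pt x1 x0) (CP1_pt y1 y0) = form_zeros 3 b"
    using G3_mult_form_zeros[OF assms, of x1 x0 y1 y0]
    unfolding Let_def p3_form_def by blast
qed

lemma commutative_G3_mult:
  assumes "c \<noteq> 0"
  shows "commutative_mult (G3_mult c)"
  unfolding commutative_mult_def
proof (intro allI)
  fix x y :: CP1
  obtain x1 x0 where x: "(x1, x0) \<noteq> (0, 0)" "x = CP1_pt x1 x0" by (rule CP1_exhaust)
  obtain y1 y0 where y: "(y1, y0) \<noteq> (0, 0)" "y = CP1_pt y1 y0" by (rule CP1_exhaust)
  have "(\<Sum>i\<le>3. monom (p3_form c x1 x0 y1 y0 i) i) = (\<Sum>i\<le>3. monom (p3_form c y1 y0 x1 x0 i) i)"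
    by (rule sum.cong) (simp_all add: p3_form_commute[of _ c x1 x0])
  then have "form_zeros 3 (p3_form c x1 x0 y1 y0) = form_zeros 3 (p3_form c y1 y0 x1 x0)"
    by (simp add: form_zeros_def)
  then show "G3_mult c x y = G3_mult c y x"
    using G3_mult_form_zeros(1)[OF assms] x y by simp
qed

lemma regular_map2_Sym_if_mult_defined_by:
  assumes "mult_defined_by n P mul"
  shows "regular_map2_Sym n mul"
proof -
  obtain a where a: "\<And>x1 x0 y1 y0. (x1, x0) \<noteq> (0, 0) \<and> (y1, y0) \<noteq> (0, 0) \<Longrightarrow>
        (\<exists>i\<le>n. (\<Sum>j\<le>n. \<Sum>k\<le>n. a i j k * x1 ^ j * x0 ^ (n - j) * y1 ^ k * y0 ^ (n - k)) \<noteq> 0) \<and>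
        mul (CP1_pt x1 x0) (CP1_pt y1 y0) = form_zeros n
          (\<lambda>i. \<Sum>j\<le>n. \<Sum>k\<le>n. a i j k * x1 ^ j * x0 ^ (n - j) * y1 ^ k * y0 ^ (n - k))"
    using assms unfolding mult_defined_by_def Let_def by (elim exE conjE) blast
  define F where "F = (\<lambda>i (v :: complex ^ 2) (w :: complex ^ 2).
    \<Sum>j\<le>n. \<Sum>k\<le>n. a i j k * v$1 ^ j * v$2 ^ (n - j) * w$1 ^ k * w$2 ^ (n - k))"
  have F: "(\<exists>i\<le>n. F i v w \<noteq> 0) \<and> mul (abs_proj v) (abs_proj w) = form_zeros n (\<lambda>i. F i v w)"
    if "v \<noteq> 0" "w \<noteq> 0" for v w
  proof -
    have "(v$1, v$2) \<noteq> (0, 0)" "(w$1, w$2) \<noteq> (0, 0)" using that by (auto simp: vec_eq_iff forall_2)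
    moreover have "v = vector [v$1, v$2]" "w = vector [w$1, w$2]" by (simp_all add: vec_eq_iff forall_2)
    then have "abs_proj v = CP1_pt (v$1) (v$2)" "abs_proj w = CP1_pt (w$1) (w$2)"
      by (metis CP1_pt_def)+
    ultimately show ?thesis using a[of "v$1" "v$2" "w$1" "w$2"] unfolding F_def by simp
  qed
  have bihom: "bihom_poly n n (F i)" for i
    unfolding F_def
  proof (intro bihom_poly_sum)
    fix j k assume "j \<in> {..n}" "k \<in> {..n}"
    have c1: "bihom_poly m 0 (\<lambda>v w. (v :: complex ^ 2) $ l ^ m)" for m l
      using bihom_poly_power[OF bihom_poly.coord1, of m l] by simp
    have c2: "bihom_poly 0 m (\<lambda>v w. (w :: complex ^ 2) $ l ^ m)" for m l
      using bihom_poly_power[OF bihom_poly.coord2, of m l] by simp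
    have "bihom_poly (0 + j + (n - j) + 0 + 0) (0 + 0 + 0 + k + (n - k))
      (\<lambda>v w. a i j k * (v :: complex ^ 2)$1 ^ j * v$2 ^ (n - j) * (w :: complex ^ 2)$1 ^ k * w$2 ^ (n - k))"
      by (intro bihom_poly.mult bihom_poly.const c1 c2)
    then show "bihom_poly n n
      (\<lambda>v w. a i j k * (v :: complex ^ 2)$1 ^ j * v$2 ^ (n - j) * (w :: complex ^ 2)$1 ^ k * w$2 ^ (n - k))"
      using \<open>j \<in> {..n}\<close> \<open>k \<in> {..n}\<close> by simp
  qed auto
  show ?thesis
    unfolding regular_map2_Sym_def
  proof (intro allI impI)
    fix v0 w0 :: "complex ^ 2" assume "v0 \<noteq> 0 \<and> w0 \<noteq> 0"
    then have "(\<forall>i\<le>n. bihom_poly n n (F i)) \<and> (\<exists>i\<le>n. F i v0 w0 \<noteq> 0) \<and>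
        (\<forall>v w. v \<noteq> 0 \<and> w \<noteq> 0 \<and> (\<exists>i\<le>n. F i v w \<noteq> 0) \<longrightarrow>
          mul (abs_proj v) (abs_proj w) = form_zeros n (\<lambda>i. F i v w))"
      using F bihom by simp
    then show "\<exists>d e F. (\<forall>i\<le>n. bihom_poly d e (F i)) \<and> (\<exists>i\<le>n. F i v0 w0 \<noteq> 0) \<and>
        (\<forall>v w. v \<noteq> 0 \<and> w \<noteq> 0 \<and> (\<exists>i\<le>n. F i v w \<noteq> 0) \<longrightarrow>
          mul (abs_proj v) (abs_proj w) = form_zeros n (\<lambda>i. F i v w))"
      by (rule exI[of _ n, OF exI[of _ n, OF exI[of _ F]]])
  qed
qed

section \<open>Coset groups are multivalued groups\<close>

lemma sum_mset_singletons: "(\<Sum>x\<in>A. {# f x #}) = {# f x. x \<in># mset_set A #}"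
  by (induction A rule: infinite_finite_induct) simp_all

text \<open>Both triple products are the multiset of all \<open>\<pi> (u \<cdot> g v \<cdot> h w)\<close> with \<open>g\<close> and \<open>h\<close> in the group of
automorphisms: on one side \<open>g (v \<cdot> h w) = g v \<cdot> (g h) w\<close>, and \<open>g h\<close> runs over the group when \<open>h\<close>
does.\<close>

lemma multivalued_group_if_coset_group:
  fixes G (structure)
  assumes "coset_group n G H p mul e iv"
  shows "multivalued_group n mul e iv"
proof -
  interpret group G using assms by (simp add: coset_group_def algebraic_group_def)
  have H: "subgroup H (AutoGroup G)" "finite H" "card H = n"
    and surj: "p ` carrier G = UNIV"
    and orbits: "\<And>u v. u \<in> carrier G \<Longrightarrow> v \<in> carrier G \<Longrightarrow> p u = p v \<longleftrightarrow> (\<exists>h\<in>H. v = h u)"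
    and mul: "\<And>u v. u \<in> carrier G \<Longrightarrow> v \<in> carrier G \<Longrightarrow>
      mul (p u) (p v) = {# p (u \<otimes> h v). h \<in># mset_set H #}"
    and e: "e = p \<one>" and iv: "\<And>u. u \<in> carrier G \<Longrightarrow> iv (p u) = p (inv u)"
    using assms by (simp_all add: coset_group_def)
  interpret A: group "AutoGroup G" by (rule AutoGroup)
  interpret H: subgroup H "AutoGroup G" by (rule H(1))
  have auto: "h \<in> auto G" if "h \<in> H" for h
    using H.subset that by (auto simp: AutoGroup_def)
  have h_closed: "h u \<in> carrier G" if "h \<in> H" "u \<in> carrier G" for h u
    using auto[OF that(1)] that(2) by (auto simp: auto_def hom_def)
  have h_mult: "h (u \<otimes> v) = h u \<otimes> h v" if "h \<in> H" "u \<in> carrier G" "v \<in> carrier G" for h u v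
    using auto[OF that(1)] that(2,3) by (auto simp: auto_def hom_def)
  have h_one: "h \<one> = \<one>" if "h \<in> H" for h
    using hom_one[of h G G] auto[OF that] by (simp add: auto_def is_group)
  have h_comp: "(g \<otimes>\<^bsub>AutoGroup G\<^esub> h) u = g (h u)" if "g \<in> H" "h \<in> H" "u \<in> carrier G" for g h u
    using auto[OF that(1)] auto[OF that(2)] that(3)
    by (simp add: AutoGroup_def BijGroup_def auto_def compose_def)
  define id where "id = \<one>\<^bsub>AutoGroup G\<^esub>"
  have id: "id \<in> H" "\<And>u. u \<in> carrier G \<Longrightarrow> id u = u"
    by (simp_all add: id_def H.one_closed) (simp add: AutoGroup_def BijGroup_def)
  have p_h: "p (h u) = p u" if "h \<in> H" "u \<in> carrier G" for h u
    using orbits[of u "h u"] that h_closed by auto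
  have mul_sum: "mul (p u) (p v) = (\<Sum>h\<in>H. {# p (u \<otimes> h v) #})"
    if "u \<in> carrier G" "v \<in> carrier G" for u v
    by (simp add: mul that sum_mset_singletons)
  have rep: "\<exists>u. u \<in> carrier G \<and> x = p u" for x using surj by (auto simp: set_eq_iff image_iff)
  have size: "size (mul x y) = n" for x y
  proof -
    obtain u where "u \<in> carrier G" "x = p u" using rep by blast
    moreover obtain v where "v \<in> carrier G" "y = p v" using rep by blast
    ultimately show ?thesis by (simp add: mul H(3))
  qed
  have assoc: "(\<Sum>t\<in>#mul y z. mul x t) = (\<Sum>t\<in>#mul x y. mul t z)" for x y z
  proof -
    obtain u where u: "u \<in> carrier G" "x = p u" using rep by blast
    obtain v where v: "v \<in> carrier G" "y = p v" using rep by blast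
    obtain w where w: "w \<in> carrier G" "z = p w" using rep by blast
    note uvw = u v w
    have "(\<Sum>t\<in>#mul y z. mul x t) = (\<Sum>h\<in>H. mul (p u) (p (v \<otimes> h w)))"
      using uvw by (simp add: mul[of v w] image_mset.compositionality comp_def sum_unfold_sum_mset)
    also have "\<dots> = (\<Sum>h\<in>H. \<Sum>g\<in>H. {# p (u \<otimes> g (v \<otimes> h w)) #})"
      by (rule sum.cong[OF refl], rule mul_sum) (use uvw h_closed in simp_all)
    also have "\<dots> = (\<Sum>h\<in>H. \<Sum>g\<in>H. {# p (u \<otimes> (g v \<otimes> (g \<otimes>\<^bsub>AutoGroup G\<^esub> h) w)) #})"
      by (intro sum.cong refl) (use uvw h_closed h_mult h_comp in simp)
    also have "\<dots> = (\<Sum>g\<in>H. \<Sum>h\<in>H. {# p (u \<otimes> (g v \<otimes> (g \<otimes>\<^bsub>AutoGroup G\<^esub> h) w)) #})"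
      by (rule sum.swap)
    also have "\<dots> = (\<Sum>g\<in>H. \<Sum>h\<in>H. {# p (u \<otimes> (g v \<otimes> h w)) #})"
    proof (rule sum.cong[OF refl])
      fix g assume g: "g \<in> H"
      have "bij_betw (\<lambda>h. g \<otimes>\<^bsub>AutoGroup G\<^esub> h) H H"
      proof (rule bij_betw_byWitness[where f' = "\<lambda>h. inv\<^bsub>AutoGroup G\<^esub> g \<otimes>\<^bsub>AutoGroup G\<^esub> h"])
        show "\<forall>h\<in>H. inv\<^bsub>AutoGroup G\<^esub> g \<otimes>\<^bsub>AutoGroup G\<^esub> (g \<otimes>\<^bsub>AutoGroup G\<^esub> h) = h"
          "\<forall>h\<in>H. g \<otimes>\<^bsub>AutoGroup G\<^esub> (inv\<^bsub>AutoGroup G\<^esub> g \<otimes>\<^bsub>AutoGroup G\<^esub> h) = h"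
          using g by (simp_all flip: A.m_assoc)
      qed (use g in auto)
      then show "(\<Sum>h\<in>H. {# p (u \<otimes> (g v \<otimes> (g \<otimes>\<^bsub>AutoGroup G\<^esub> h) w)) #}) =
          (\<Sum>h\<in>H. {# p (u \<otimes> (g v \<otimes> h w)) #})"
        by (rule sum.reindex_bij_betw)
    qed
    also have "\<dots> = (\<Sum>g\<in>H. \<Sum>h\<in>H. {# p ((u \<otimes> g v) \<otimes> h w) #})"
      by (intro sum.cong refl) (use uvw h_closed m_assoc in simp)
    also have "\<dots> = (\<Sum>g\<in>H. mul (p (u \<otimes> g v)) (p w))"
      by (rule sum.cong[OF refl], rule mul_sum[symmetric]) (use uvw h_closed in simp_all)
    also have "\<dots> = (\<Sum>t\<in>#mul x y. mul t z)"
      using uvw by (simp add: mul[of u v] image_mset.compositionality comp_def sum_unfold_sum_mset)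
    finally show ?thesis .
  qed
  have neutral: "mul x e = replicate_mset n x \<and> mul e x = replicate_mset n x" for x
  proof -
    obtain u where u: "u \<in> carrier G" "x = p u" using rep by blast
    have const: "{# f h. h \<in># mset_set H #} = replicate_mset n x" if "\<And>h. h \<in> H \<Longrightarrow> f h = x" for f
    proof -
      have "{# f h. h \<in># mset_set H #} = {# x. h \<in># mset_set H #}"
        using H(2) that by (intro image_mset_cong) simp
      then show ?thesis by (simp add: H(3) image_mset_const_eq)
    qed
    have "p (u \<otimes> h \<one>) = x" "p (\<one> \<otimes> h u) = x" if "h \<in> H" for h
      using h_one[OF that] h_closed[OF that u(1)] p_h[OF that u(1)] u by simp_all
    then have "{# p (u \<otimes> h \<one>). h \<in># mset_set H #} = replicate_mset n x"
      "{# p (\<one> \<otimes> h u). h \<in># mset_set H #} = replicate_mset n x"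
      by (intro const; simp)+
    then show ?thesis
      using mul[OF u(1) one_closed] mul[OF one_closed u(1)] e u(2) by simp
  qed
  have inverse: "e \<in># mul x (iv x) \<and> e \<in># mul (iv x) x" for x
  proof -
    obtain u where u: "u \<in> carrier G" "x = p u" using rep by blast
    have "p (u \<otimes> id (inv u)) = e" "p (inv u \<otimes> id u) = e" using u id(2) e by simp_all
    then show ?thesis
      unfolding u(2) iv[OF u(1)] mul[OF u(1) inv_closed[OF u(1)]] mul[OF inv_closed[OF u(1)] u(1)]
      using id(1) H(2) by (metis (no_types, lifting) finite_set_mset_mset_set image_eqI set_image_mset)
  qed
  show ?thesis
    unfolding multivalued_group_def using size assoc neutral inverse by blast
qed

section \<open>The three-valued group and its isomorphisms\<close>

lemma coset_group_G3:
  assumes "c \<noteq> 0"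
  shows "coset_group 3 (curve_group c) (phi3_group c) curve_proj (G3_mult c) (of_complex 0) CP1_uminus"
proof -
  have "\<forall>h\<in>phi3_group c. algebraic_group_iso (curve_group c) (curve_group c) h"
    using rotation_iso[OF assms] by (auto simp: phi3_group_image[OF assms])
  moreover have "finite (phi3_group c)"
    by (simp add: phi3_group_image[OF assms])
  ultimately show ?thesis
    unfolding coset_group_def
    using algebraic_group_curve_group[OF assms] phi3_group_eq(2)[OF assms] card_phi3_group[OF assms]
      regular_map_curve_proj curve_proj_surj curve_proj_eq_iff[OF assms] G3_mult_curve_proj[OF assms]
      CP1_uminus_curve_proj[OF assms]
    by (simp add: curve_proj_inf of_complex_def)
qed

lemma is_G3_G3_mult:
  assumes "c \<noteq> 0"
  shows "is_G3 c (G3_mult c)"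
  unfolding is_G3_def regular_algebraic_multivalued_group_def
  using multivalued_group_if_coset_group[OF coset_group_G3[OF assms]]
    regular_map2_Sym_if_mult_defined_by[OF mult_defined_by_G3_mult[OF assms]]
    regular_map_CP1_uminus commutative_G3_mult[OF assms] coset_group_G3[OF assms]
    mult_defined_by_G3_mult[OF assms]
  by blast

lemma curve_proj_curve_scale:
  assumes "\<mu> \<noteq> 0" "\<nu> \<noteq> 0" "u \<in> curve c"
  shows "curve_proj (curve_scale \<mu> \<nu> u) = diag_act (vector [1, \<nu>]) (curve_proj u)"
proof -
  have diag: "diag_act (vector [1, \<nu>]) (CP1_pt a b) = CP1_pt a (\<nu> * b)" if "(a, b) \<noteq> (0, 0)" for a b
  proof -
    have nz: "vector [a, b] \<noteq> (0 :: complex ^ 2)" using that by (auto simp: vec_eq_iff forall_2)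
    have \<nu>: "\<forall>i. (vector [1, \<nu>] :: complex ^ 2) $ i \<noteq> 0" using assms(2) by (simp add: forall_2)
    have eq: "(\<chi> i. (vector [1, \<nu>] :: complex ^ 2) $ i * (vector [a, b] :: complex ^ 2) $ i) =
        vector [a, \<nu> * b]"
      by (simp add: vec_eq_iff forall_2)
    show ?thesis unfolding CP1_pt_def diag_act_abs_proj[OF \<nu> nz] eq ..
  qed
  show ?thesis
    using assms(3) by (cases rule: curve_cases)
      (use assms(1,2) in \<open>simp_all add: curve_proj_inf curve_proj_aff diag CP1_pt_eq_iff\<close>)
qed

text \<open>For \<open>t ^ 6 = c' / c\<close> the map \<open>(\<zeta>, \<eta>) \<mapsto> (t ^ 2 \<zeta>, t ^ 3 \<eta>)\<close> is an isomorphism of the curves that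
commutes with the rotations, and on the line it induces the multiplication of \<open>1 / \<eta>\<close> by a
constant.  It respects the three-valued products because these are determined by the groups.\<close>

lemma coset_isomorphic_G3:
  assumes "c \<noteq> 0" "c' \<noteq> 0" "is_G3 c mul" "is_G3 c' mul'"
  shows "coset_isomorphic (curve_group c) (phi3_group c) curve_proj mul
    (curve_group c') (phi3_group c') curve_proj mul'"
proof -
  obtain t where t: "c' / c = t ^ 6" by (rule exists_complex_root[of 6]) simp
  define \<mu> where "\<mu> = t ^ 2"
  define \<nu> where "\<nu> = t ^ 3"
  have t0: "t \<noteq> 0" using t assms(1,2) by auto
  have \<mu>\<nu>: "\<mu> \<noteq> 0" "\<nu> \<noteq> 0" "\<nu> ^ 2 = \<mu> ^ 3" "c' = \<nu> ^ 2 * c"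
    using t t0 assms(1) by (auto simp: \<mu>_def \<nu>_def power_mult[symmetric] field_simps)
  obtain r k where "fermat_model c r k" using exists_fermat_model assms by blast
  then interpret fermat_model c r k .
  define f where "f = curve_scale \<mu> \<nu>"
  define \<phi> :: "CP1 \<Rightarrow> CP1" where "\<phi> = diag_act (vector [1, \<nu>])"
  have f_curve: "f u \<in> curve c'" if "u \<in> curve c" for u
    using curve_scale_in_curve[OF \<mu>\<nu>(1-3) that] by (simp add: f_def \<mu>\<nu>(4))
  have f_rotation: "f (rotation c j u) = rotation c' j (f u)" if "u \<in> curve c" for j u
    using that f_curve[OF that] \<mu>\<nu>(1,2)
    by (simp add: rotation_apply f_def curve_scale_curve_scale[OF _ _ _ _ that] mult.commute)
  have f_add: "f (curve_add u (rotation c j v)) = curve_add (f u) (rotation c' j (f v))"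
    if "u \<in> curve c" "v \<in> curve c" for u v j
    using curve_scale_add[OF \<mu>\<nu>(1-3) that(1) rotation_in_curve[OF that(2)], of j] f_rotation[OF that(2), of j]
    by (simp add: f_def)
  have \<phi>_proj: "curve_proj (f u) = \<phi> (curve_proj u)" if "u \<in> curve c" for u
    using curve_proj_curve_scale[OF \<mu>\<nu>(1,2) that] by (simp add: f_def \<phi>_def)
  have mul: "mul (curve_proj u) (curve_proj v) =
      {# curve_proj (curve_add u (h v)). h \<in># mset_set (phi3_group c) #}"
    if "u \<in> curve c" "v \<in> curve c" for u v
    using assms(3) that by (simp add: is_G3_def coset_group_def)
  have mul': "mul' (curve_proj u) (curve_proj v) =
      {# curve_proj (curve_add u (h v)). h \<in># mset_set (phi3_group c') #}"
    if "u \<in> curve c'" "v \<in> curve c'" for u v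
    using assms(4) that by (simp add: is_G3_def coset_group_def)
  have "algebraic_group_iso (curve_group c) (curve_group c') f"
    by (rule algebraic_group_iso_curve_scale[OF \<mu>\<nu>(1-3) assms(1) \<mu>\<nu>(4)]) (simp add: f_def)
  moreover have "biregular UNIV UNIV \<phi>"
  proof (rule biregular_diag_act[of "vector [1, \<nu>]"])
    show d: "\<forall>i. (vector [1, \<nu>] :: complex ^ 2) $ i \<noteq> 0" using \<mu>\<nu>(2) by (simp add: forall_2)
    have "p = diag_act (vector [1, \<nu>]) (diag_act (vector [1, 1 / \<nu>]) p)" for p :: CP1
    proof -
      have "(\<chi> i. (vector [1, \<nu>] :: complex ^ 2) $ i * (vector [1, 1 / \<nu>] :: complex ^ 2) $ i) = (\<chi> i. 1)"
        using \<mu>\<nu>(2) by (simp add: vec_eq_iff forall_2)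
      then show ?thesis using \<mu>\<nu>(2) by (subst diag_act_diag_act) (simp_all add: forall_2 diag_act_1)
    qed
    then show "range (diag_act (vector [1, \<nu>])) = (UNIV :: CP1 set)" by (rule surjI[OF sym])
  qed (simp add: \<phi>_def)
  moreover have "\<forall>m\<in>carrier (curve_group c). curve_proj (f m) = \<phi> (curve_proj m)"
    using \<phi>_proj by simp
  moreover have "\<forall>u\<in>carrier (curve_group c). \<forall>v\<in>carrier (curve_group c).
      image_mset f {# u \<otimes>\<^bsub>curve_group c\<^esub> a v. a \<in># mset_set (phi3_group c) #} =
      {# f u \<otimes>\<^bsub>curve_group c'\<^esub> b (f v). b \<in># mset_set (phi3_group c') #}"
    using f_add by (simp add: mset_phi3_group assms(1,2))
  moreover have "\<forall>x y. image_mset \<phi> (mul x y) = mul' (\<phi> x) (\<phi> y)"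
  proof (intro allI)
    fix x y :: CP1
    have rep: "\<exists>u. u \<in> curve c \<and> p = curve_proj u" for p
      using curve_proj_surj[of c] by (auto simp: set_eq_iff image_iff)
    obtain u where u: "u \<in> curve c" "x = curve_proj u" using rep by blast
    obtain v where v: "v \<in> curve c" "y = curve_proj v" using rep by blast
    note uv = u v
    have sum: "curve_add u (rotation c j v) \<in> curve c" for j
      by (intro curve_add_closed rotation_in_curve uv)
    have "mul' (\<phi> x) (\<phi> y) = mul' (curve_proj (f u)) (curve_proj (f v))"
      using uv \<phi>_proj by simp
    also have "\<dots> = image_mset \<phi> (mul x y)"
      unfolding mul'[OF f_curve[OF uv(1)] f_curve[OF uv(3)]] uv(2,4) mul[OF uv(1,3)]
        mset_phi3_group[OF assms(1)] mset_phi3_group[OF assms(2)]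
      using uv sum by (simp add: \<phi>_proj flip: f_add)
    finally show "image_mset \<phi> (mul x y) = mul' (\<phi> x) (\<phi> y)" by simp
  qed
  ultimately show ?thesis
    unfolding coset_isomorphic_def by (intro exI[of _ f] exI[of _ \<phi>] conjI)
qed

lemma symmetric3_p3: "symmetric3 (p3 c)"
  unfolding symmetric3_def p3_def Let_def by (simp add: algebra_simps)

theorem theorem3:
  shows "(\<forall>c. c \<noteq> 0 \<longrightarrow> symmetric3 (p3 c) \<and> (\<exists>mul. is_G3 c mul)) \<and>
    (\<forall>c c' mul mul'. c \<noteq> 0 \<and> c' \<noteq> 0 \<and> is_G3 c mul \<and> is_G3 c' mul' \<longrightarrow>
      coset_isomorphic (curve_group c) (phi3_group c) curve_proj mul
        (curve_group c') (phi3_group c') curve_proj mul')"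
  using symmetric3_p3 is_G3_G3_mult coset_isomorphic_G3 by blast

end
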